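(* Suppose $\beta\ge1+C_F^2$. Let $f\in L^2(\Omega)$, $g\in H_0^1(\Omega)$, and let $\boldsymbol{u}=(u,\boldsymbol{\sigma},\lambda)\in K^s$ denote the solution of $$a_\beta(\boldsymbol{u},\boldsymbol{v}-\boldsymbol{u})\ge F_\beta(\boldsymbol{v}-\boldsymbol{u})\quad\text{for all }\boldsymbol{v}\in K^s .$$ Let $K_h\subset U$ be a non-empty convex and closed subset and let $\boldsymbol{u}_h=(u_h,\boldsymbol{\sigma}_h,\lambda_h)\in K_h$ denote the solution of $$a_\beta(\boldsymbol{u}_h,\boldsymbol{v}_h-\boldsymbol{u}_h)\ge F_\beta(\boldsymbol{v}_h-\boldsymbol{u}_h)\quad\text{for all }\boldsymbol{v}_h\in K_h .$$ Then, with a constant $C_{\mathrm{opt}}>0$ depending only on $\beta$ and $\Omega$, $$\|\boldsymbol{u}-\boldsymbol{u}_h\|_U^2\le C_{\mathrm{opt}}\Big(\inf_{\boldsymbol{v}_h\in K_h}\big(\|\boldsymbol{u}-\boldsymbol{v}_h\|_U^2+|\langle\lambda,v_h-u\rangle+\langle\mu_h-\lambda,u-g\rangle|\big)+\inf_{\boldsymbol{v}\in K^s}|\langle\lambda,v-u_h\rangle+\langle\mu-\lambda_h,u-g\rangle|\Big),$$ where $\boldsymbol{v}_h=(v_h,\boldsymbol{\tau}_h,\mu_h)$ and $\boldsymbol{v}=(v,\boldsymbol{\tau},\mu)$.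
   Context: $\Omega\subset\mathbb{R}^n$, $n\in\{2,3\}$, is a polygonal (polyhedral) bounded Lipschitz domain. $(\cdot,\cdot)$ and $\|\cdot\|$ are the $L^2(\Omega)$ (or $L^2(\Omega)^n$) inner product and norm. $H^{-1}(\Omega)$ is the dual of $H_0^1(\Omega)$, with duality $\langle\cdot,\cdot\rangle$ extending the $L^2(\Omega)$ inner product. The generalized divergence $\operatorname{div}:L^2(\Omega)^n\to H^{-1}(\Omega)$ is $\langle\operatorname{div}\boldsymbol{\sigma},v\rangle:=-(\boldsymbol{\sigma},\nabla v)$ for $v\in H_0^1(\Omega)$. $C_F=C_F(\Omega)$, $0<C_F\le\operatorname{diam}(\Omega)$, is the constant in Friedrichs' inequality $\|v\|\le C_F\|\nabla v\|$ for all $v\in H_0^1(\Omega)$. For $v\in H^1(\Omega)$, $v\ge0$ means $v\ge 0$ a.e. in $\Omega$; for $\lambda\in H^{-1}(\Omega)$, $\lambda\ge0$ means $\langle\lambda,v\rangle\ge0$ for all $v\in H_0^1(\Omega)$ with $v\ge0$. $U:=\{(u,\boldsymbol{\sigma},\lambda)\in H_0^1(\Omega)\times L^2(\Omega)^n\times H^{-1}(\Omega): \operatorname{div}\boldsymbol{\sigma}+\lambda\in L^2(\Omega)\}$ with norm $\|(u,\boldsymbol{\sigma},\lambda)\|_U^2:=\|\nabla u\|^2+\|\boldsymbol{\sigma}\|^2+\|\operatorname{div}\boldsymbol{\sigma}+\lambda\|^2$. $K^s:=\{(u,\boldsymbol{\sigma},\lambda)\in U: u-g\ge0,\ \lambda\ge0\}$.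 For $\boldsymbol{u}=(u,\boldsymbol{\sigma},\lambda)$, $\boldsymbol{v}=(v,\boldsymbol{\tau},\mu)\in U$: $a_\beta(\boldsymbol{u},\boldsymbol{v}):=\beta(\operatorname{div}\boldsymbol{\sigma}+\lambda,\operatorname{div}\boldsymbol{\tau}+\mu)+(\nabla u-\boldsymbol{\sigma},\nabla v-\boldsymbol{\tau})+\tfrac12(\langle\mu,u\rangle+\langle\lambda,v\rangle)$, $F_\beta(\boldsymbol{v}):=-\beta(f,\operatorname{div}\boldsymbol{\tau}+\mu)+\tfrac12\langle\mu,g\rangle$. Both variational inequalities are uniquely solvable. The solution $\boldsymbol{u}$ of the first one is $(u,\nabla u,-\Delta u-f)$, where $u\in H_0^1(\Omega)$, $u\ge g$, is the solution of the classical obstacle problem $(\nabla u,\nabla(v-u))\ge(f,v-u)$ for all $v\in H_0^1(\Omega)$, $v\ge g$. *)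

theory Defs
  imports "HOL-Analysis.Analysis" "HOL-Library.Function_Algebras"
begin

text \<open>
  Elements of $L^2(\Omega)$, $H^1(\Omega)$ and $H_0^1(\Omega)$ are given by representatives: total
  functions on the ambient space of which only the restriction to $\Omega$ matters, and only up to
  null sets. Elements of $H^{-1}(\Omega)$ are real functions of such representatives of which only
  the values on $H_0^1(\Omega)$ matter. All vector space operations are pointwise.
\<close>

instantiation "fun" :: (type, real_vector) real_vector
begin

definition scaleR_fun :: "real \<Rightarrow> ('a \<Rightarrow> 'b) \<Rightarrow> 'a \<Rightarrow> 'b" where
  "scaleR_fun c f = (\<lambda>x. c *\<^sub>R f x)"

instance
  by standard (auto simp: scaleR_fun_def fun_eq_iff scaleR_add_right scaleR_add_left)

end


subsection \<open>Polyhedral Lipschitz domains\<close>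

text \<open>
  Near each boundary point the domain is the strict epigraph of a Lipschitz function defined on
  the hyperplane through the origin orthogonal to a suitable unit vector \<open>\<nu>\<close>.
\<close>
definition lipschitz_boundary :: "'a::euclidean_space set \<Rightarrow> bool" where
  "lipschitz_boundary \<Omega> \<longleftrightarrow>
     (\<forall>x\<in>frontier \<Omega>. \<exists>r>0. \<exists>\<nu> L \<gamma>. norm \<nu> = 1 \<and> L-lipschitz_on {y. \<nu> \<bullet> y = 0} \<gamma> \<and>
        (\<forall>y\<in>ball x r. y \<in> \<Omega> \<longleftrightarrow> \<gamma> (y - (\<nu> \<bullet> y) *\<^sub>R \<nu>) < \<nu> \<bullet> y))"

definition lipschitz_domain :: "'a::euclidean_space set \<Rightarrow> bool" where
  "lipschitz_domain \<Omega> \<longleftrightarrow>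
     open \<Omega> \<and> connected \<Omega> \<and> \<Omega> \<noteq> {} \<and> bounded \<Omega> \<and> lipschitz_boundary \<Omega>"

text \<open>The domain need not be convex, whereas a \<open>polytope\<close> is.\<close>
definition polyhedral_domain :: "'a::euclidean_space set \<Rightarrow> bool" where
  "polyhedral_domain \<Omega> \<longleftrightarrow> (\<exists>\<P>. finite \<P> \<and> (\<forall>P\<in>\<P>. polytope P) \<and> closure \<Omega> = \<Union>\<P>)"


subsection \<open>Lebesgue and Sobolev spaces\<close>

definition L2 :: "'a::euclidean_space set \<Rightarrow> ('a \<Rightarrow> 'b::euclidean_space) set" where
  "L2 \<Omega> = {f. f \<in> borel_measurable (lebesgue_on \<Omega>) \<and>
               integrable (lebesgue_on \<Omega>) (\<lambda>x. (norm (f x))\<^sup>2)}"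

definition L2_inner ::
  "'a::euclidean_space set \<Rightarrow> ('a \<Rightarrow> 'b::euclidean_space) \<Rightarrow> ('a \<Rightarrow> 'b) \<Rightarrow> real" where
  "L2_inner \<Omega> f g = (\<integral>x. f x \<bullet> g x \<partial>lebesgue_on \<Omega>)"

definition L2_norm :: "'a::euclidean_space set \<Rightarrow> ('a \<Rightarrow> 'b::euclidean_space) \<Rightarrow> real" where
  "L2_norm \<Omega> f = sqrt (L2_inner \<Omega> f f)"

definition partial_deriv :: "'a::euclidean_space \<Rightarrow> ('a \<Rightarrow> real) \<Rightarrow> 'a \<Rightarrow> real" where
  "partial_deriv i f x = frechet_derivative f (at x) i"

primrec C_times :: "nat \<Rightarrow> ('a::euclidean_space \<Rightarrow> real) \<Rightarrow> bool" where
  "C_times 0 f \<longleftrightarrow> continuous_on UNIV f"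
| "C_times (Suc k) f \<longleftrightarrow>
     f differentiable_on UNIV \<and> (\<forall>i\<in>Basis. C_times k (partial_deriv i f))"

text \<open>The space $C_c^\infty(\Omega)$, with functions extended by zero to the whole space.\<close>
definition test_functions :: "'a::euclidean_space set \<Rightarrow> ('a \<Rightarrow> real) set" where
  "test_functions \<Omega> =
     {\<phi>. (\<forall>k. C_times k \<phi>) \<and> (\<exists>S. compact S \<and> S \<subseteq> \<Omega> \<and> (\<forall>x. x \<notin> S \<longrightarrow> \<phi> x = 0))}"

definition is_weak_gradient ::
  "'a::euclidean_space set \<Rightarrow> ('a \<Rightarrow> real) \<Rightarrow> ('a \<Rightarrow> 'a) \<Rightarrow> bool" where
  "is_weak_gradient \<Omega> v G \<longleftrightarrow>
     (\<forall>\<phi>\<in>test_functions \<Omega>. \<forall>i\<in>Basis.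
        L2_inner \<Omega> v (partial_deriv i \<phi>) = - L2_inner \<Omega> (\<lambda>x. G x \<bullet> i) \<phi>)"

definition H1 :: "'a::euclidean_space set \<Rightarrow> ('a \<Rightarrow> real) set" where
  "H1 \<Omega> = {v \<in> L2 \<Omega>. \<exists>G\<in>L2 \<Omega>. is_weak_gradient \<Omega> v G}"

text \<open>For \<open>v \<in> H1 \<Omega>\<close>, weak gradients are unique up to null sets; one of them is chosen.\<close>
definition grad :: "'a::euclidean_space set \<Rightarrow> ('a \<Rightarrow> real) \<Rightarrow> 'a \<Rightarrow> 'a" where
  "grad \<Omega> v = (SOME G. G \<in> L2 \<Omega> \<and> is_weak_gradient \<Omega> v G)"

definition H1_norm :: "'a::euclidean_space set \<Rightarrow> ('a \<Rightarrow> real) \<Rightarrow> real" where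
  "H1_norm \<Omega> v = sqrt ((L2_norm \<Omega> v)\<^sup>2 + (L2_norm \<Omega> (grad \<Omega> v))\<^sup>2)"

definition H01 :: "'a::euclidean_space set \<Rightarrow> ('a \<Rightarrow> real) set" where
  "H01 \<Omega> = {v \<in> H1 \<Omega>. \<forall>\<epsilon>>0. \<exists>\<phi>\<in>test_functions \<Omega>. H1_norm \<Omega> (v - \<phi>) < \<epsilon>}"

definition Hm1 :: "'a::euclidean_space set \<Rightarrow> (('a \<Rightarrow> real) \<Rightarrow> real) set" where
  "Hm1 \<Omega> = {l. (\<forall>v\<in>H01 \<Omega>. \<forall>w\<in>H01 \<Omega>. l (v + w) = l v + l w) \<and>
               (\<forall>c. \<forall>v\<in>H01 \<Omega>. l (c *\<^sub>R v) = c * l v) \<and>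
               (\<exists>C. \<forall>v\<in>H01 \<Omega>. \<bar>l v\<bar> \<le> C * H1_norm \<Omega> v)}"

definition friedrichs_constant :: "'a::euclidean_space set \<Rightarrow> real \<Rightarrow> bool" where
  "friedrichs_constant \<Omega> C \<longleftrightarrow>
     0 < C \<and> C \<le> diameter \<Omega> \<and> (\<forall>v\<in>H01 \<Omega>. L2_norm \<Omega> v \<le> C * L2_norm \<Omega> (grad \<Omega> v))"

definition nonneg_ae :: "'a::euclidean_space set \<Rightarrow> ('a \<Rightarrow> real) \<Rightarrow> bool" where
  "nonneg_ae \<Omega> v \<longleftrightarrow> (AE x in lebesgue_on \<Omega>. 0 \<le> v x)"

definition nonneg_functional ::
  "'a::euclidean_space set \<Rightarrow> (('a \<Rightarrow> real) \<Rightarrow> real) \<Rightarrow> bool" where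
  "nonneg_functional \<Omega> l \<longleftrightarrow> (\<forall>v\<in>H01 \<Omega>. nonneg_ae \<Omega> v \<longrightarrow> 0 \<le> l v)"

definition weak_div :: "'a::euclidean_space set \<Rightarrow> ('a \<Rightarrow> 'a) \<Rightarrow> ('a \<Rightarrow> real) \<Rightarrow> real" where
  "weak_div \<Omega> \<sigma> = (\<lambda>v. - L2_inner \<Omega> \<sigma> (grad \<Omega> v))"

definition represents ::
  "'a::euclidean_space set \<Rightarrow> ('a \<Rightarrow> real) \<Rightarrow> (('a \<Rightarrow> real) \<Rightarrow> real) \<Rightarrow> bool" where
  "represents \<Omega> w l \<longleftrightarrow> w \<in> L2 \<Omega> \<and> (\<forall>v\<in>H01 \<Omega>. l v = L2_inner \<Omega> w v)"


subsection \<open>The space \<open>U\<close> and the variational inequality\<close>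

type_synonym 'a triple = "('a \<Rightarrow> real) \<times> ('a \<Rightarrow> 'a) \<times> (('a \<Rightarrow> real) \<Rightarrow> real)"

definition U_space :: "'a::euclidean_space set \<Rightarrow> 'a triple set" where
  "U_space \<Omega> = {(u, \<sigma>, l). u \<in> H01 \<Omega> \<and> \<sigma> \<in> L2 \<Omega> \<and> l \<in> Hm1 \<Omega> \<and>
                  (\<exists>w. represents \<Omega> w (weak_div \<Omega> \<sigma> + l))}"

text \<open>The $L^2(\Omega)$ function $\mathrm{div}\,\sigma + \lambda$, unique up to null sets.\<close>
definition div_plus ::
  "'a::euclidean_space set \<Rightarrow> ('a \<Rightarrow> 'a) \<Rightarrow> (('a \<Rightarrow> real) \<Rightarrow> real) \<Rightarrow> 'a \<Rightarrow> real" where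
  "div_plus \<Omega> \<sigma> l = (SOME w. represents \<Omega> w (weak_div \<Omega> \<sigma> + l))"

definition U_norm :: "'a::euclidean_space set \<Rightarrow> 'a triple \<Rightarrow> real" where
  "U_norm \<Omega> = (\<lambda>(u, \<sigma>, l).
     sqrt ((L2_norm \<Omega> (grad \<Omega> u))\<^sup>2 + (L2_norm \<Omega> \<sigma>)\<^sup>2 + (L2_norm \<Omega> (div_plus \<Omega> \<sigma> l))\<^sup>2))"

text \<open>
  Closedness in the seminorm on representatives. It forces \<open>K\<close> to be a union of equivalence
  classes, so such sets correspond exactly to the closed subsets of the normed space $U$.
\<close>
definition U_closed :: "'a::euclidean_space set \<Rightarrow> 'a triple set \<Rightarrow> bool" where
  "U_closed \<Omega> K \<longleftrightarrow>
     (\<forall>x. \<forall>y\<in>U_space \<Omega>. (\<forall>k. x k \<in> K) \<and> (\<lambda>k::nat. U_norm \<Omega> (x k - y)) \<longlonglongrightarrow> 0 \<longrightarrow> y \<in> K)"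

definition Ks :: "'a::euclidean_space set \<Rightarrow> ('a \<Rightarrow> real) \<Rightarrow> 'a triple set" where
  "Ks \<Omega> g = {(u, \<sigma>, l) \<in> U_space \<Omega>. nonneg_ae \<Omega> (u - g) \<and> nonneg_functional \<Omega> l}"

definition a_form ::
  "'a::euclidean_space set \<Rightarrow> real \<Rightarrow> 'a triple \<Rightarrow> 'a triple \<Rightarrow> real" where
  "a_form \<Omega> \<beta> = (\<lambda>(u, \<sigma>, l) (v, \<tau>, m).
     \<beta> * L2_inner \<Omega> (div_plus \<Omega> \<sigma> l) (div_plus \<Omega> \<tau> m)
     + L2_inner \<Omega> (grad \<Omega> u - \<sigma>) (grad \<Omega> v - \<tau>)
     + (m u + l v) / 2)"

definition F_form ::
  "'a::euclidean_space set \<Rightarrow> real \<Rightarrow> ('a \<Rightarrow> real) \<Rightarrow> ('a \<Rightarrow> real) \<Rightarrow> 'a triple \<Rightarrow> real" where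
  "F_form \<Omega> \<beta> f g = (\<lambda>(v, \<tau>, m). - \<beta> * L2_inner \<Omega> f (div_plus \<Omega> \<tau> m) + m g / 2)"

definition solves_VI ::
  "'a::euclidean_space set \<Rightarrow> real \<Rightarrow> ('a \<Rightarrow> real) \<Rightarrow> ('a \<Rightarrow> real) \<Rightarrow> 'a triple set \<Rightarrow> 'a triple \<Rightarrow> bool"
  where
  "solves_VI \<Omega> \<beta> f g K x \<longleftrightarrow>
     x \<in> K \<and> (\<forall>y\<in>K. a_form \<Omega> \<beta> x (y - x) \<ge> F_form \<Omega> \<beta> f g (y - x))"

end

theory Submission
  imports Defs
begin

text \<open>
  The estimate is Falk's lemma for variational inequalities, applied to two different convex sets,
  neither of which need contain the other. Three properties of the form carry it. It is coercive on
  \<open>U\<close> as soon as \<open>\<beta> \<ge> 1 + C\<^sub>F\<^sup>2\<close> (\<open>a_form_coercive\<close>), it is bounded (\<open>a_form_bounded\<close>), and it is consistent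
  with the obstacle problem (\<open>obstacle_VI_consistency\<close>): for the exact solution, \<open>a (x, z) - F z\<close>
  consists of the duality terms \<open>(\<langle>\<lambda>, v\<rangle> + \<langle>\<mu>, u - g\<rangle>) / 2\<close> for every \<open>z = (v, \<tau>, \<mu>)\<close> in \<open>U\<close>. The constants depend
  on \<open>\<beta>\<close> and \<open>C\<^sub>F\<close> only.

  Consistency says that the residuals \<open>w = \<beta> (div \<sigma> + \<lambda> + f)\<close> and \<open>s = \<nabla>u - \<sigma>\<close> vanish. Instead of
  solving the obstacle problem and appealing to uniqueness, this is read off from the variational
  inequality. Varying \<open>\<sigma>\<close> by fields \<open>\<tau>\<close> with \<open>div \<tau> \<in> L\<^sup>2\<close> gives \<open>(w, div \<tau>) = (s, \<tau>)\<close>, hence \<open>w \<in> H\<^sub>0\<^sup>1\<close> and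
  \<open>\<nabla>w = - s\<close> (\<open>H01_if_orthogonal_to_divergences\<close>). Varying \<open>\<lambda>\<close> by non-negative \<open>L\<^sup>2\<close> functions gives
  \<open>w + (u - g) / 2 \<ge> 0\<close>, so that \<open>u + 2 w\<close> is an admissible competitor for \<open>u\<close>, and this one yields
  \<open>2 (s, s) \<le> \<langle>\<lambda>, w\<rangle>\<close>. Finally \<open>(u, 0, 0)\<close> as a competitor yields \<open>\<langle>\<lambda>, w\<rangle> \<le> - \<langle>\<lambda>, u - g\<rangle> / 2 \<le> 0\<close>. So \<open>s = 0\<close>,
  and \<open>w = 0\<close> by Friedrichs' inequality.

  The step to \<open>w \<in> H\<^sub>0\<^sup>1\<close> is an orthogonal projection in \<open>L\<^sup>2\<close> onto the graph of the gradient on \<open>H\<^sub>0\<^sup>1\<close> and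
  rests on the completeness of \<open>L\<^sup>2\<close> (\<open>L2_complete\<close>, \<open>L2_projection\<close>). Linearity of the gradient and of
  \<open>div \<sigma> + \<lambda>\<close>, on which bilinearity of the form depends, amounts to their uniqueness up to null sets,
  that is, to the fundamental lemma of the calculus of variations
  (\<open>test_functions_fundamental_lemma\<close>).
\<close>


section \<open>The space of square integrable functions\<close>

lemma L2_iff:
  "f \<in> L2 \<Omega> \<longleftrightarrow> f \<in> borel_measurable (lebesgue_on \<Omega>) \<and>
    integrable (lebesgue_on \<Omega>) (\<lambda>x. f x \<bullet> f x)"
  by (simp add: L2_def power2_norm_eq_inner)

lemma L2_measurable [measurable_dest]: "f \<in> L2 \<Omega> \<Longrightarrow> f \<in> borel_measurable (lebesgue_on \<Omega>)"
  by (simp add: L2_def)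

lemma L2_integrable_inner:
  assumes "f \<in> L2 \<Omega>" "g \<in> L2 \<Omega>"
  shows "integrable (lebesgue_on \<Omega>) (\<lambda>x. f x \<bullet> g x)"
proof (rule Bochner_Integration.integrable_bound)
  show "integrable (lebesgue_on \<Omega>) (\<lambda>x. (norm (f x))\<^sup>2 + (norm (g x))\<^sup>2)"
    using assms by (simp add: L2_def)
  show "(\<lambda>x. f x \<bullet> g x) \<in> borel_measurable (lebesgue_on \<Omega>)"
    using assms L2_measurable by measurable
  have "\<bar>f x \<bullet> g x\<bar> \<le> (norm (f x))\<^sup>2 + (norm (g x))\<^sup>2" for x
  proof -
    have "\<bar>f x \<bullet> g x\<bar> \<le> norm (f x) * norm (g x)" by (rule Cauchy_Schwarz_ineq2)
    moreover have "2 * (norm (f x) * norm (g x)) \<le> (norm (f x))\<^sup>2 + (norm (g x))\<^sup>2"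
      using sum_squares_bound[of "norm (f x)" "norm (g x)"] by (simp add: mult.assoc)
    moreover have "0 \<le> norm (f x) * norm (g x)" by simp
    ultimately show ?thesis by linarith
  qed
  then show "AE x in lebesgue_on \<Omega>. norm (f x \<bullet> g x) \<le> norm ((norm (f x))\<^sup>2 + (norm (g x))\<^sup>2)"
    by (intro AE_I2) auto
qed

lemma L2_zero [simp]: "0 \<in> L2 \<Omega>"
  by (simp add: L2_def zero_fun_def)

lemma L2_add [intro]:
  assumes "f \<in> L2 \<Omega>" "g \<in> L2 \<Omega>"
  shows "f + g \<in> L2 \<Omega>"
proof -
  have "(\<lambda>x. f x + g x) \<in> borel_measurable (lebesgue_on \<Omega>)"
    using assms L2_measurable by measurable
  moreover have "integrable (lebesgue_on \<Omega>)
      (\<lambda>x. f x \<bullet> f x + f x \<bullet> g x + (g x \<bullet> f x + g x \<bullet> g x))"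
    using assms by (intro Bochner_Integration.integrable_add L2_integrable_inner)
  ultimately show ?thesis
    by (simp add: L2_iff plus_fun_def inner_add_left inner_add_right add_ac)
qed

lemma L2_scaleR [intro]:
  assumes "f \<in> L2 \<Omega>"
  shows "c *\<^sub>R f \<in> L2 \<Omega>"
proof -
  have "(\<lambda>x. c *\<^sub>R f x) \<in> borel_measurable (lebesgue_on \<Omega>)"
    using L2_measurable[OF assms] by measurable
  moreover have "integrable (lebesgue_on \<Omega>) (\<lambda>x. (c *\<^sub>R f x) \<bullet> (c *\<^sub>R f x))"
    using L2_integrable_inner[OF assms assms] by simp
  ultimately show ?thesis
    unfolding L2_iff scaleR_fun_def by blast
qed

lemma L2_minus [intro]: "f \<in> L2 \<Omega> \<Longrightarrow> - f \<in> L2 \<Omega>"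
  using L2_scaleR[of f \<Omega> "-1"] by simp

lemma L2_diff [intro]: "f \<in> L2 \<Omega> \<Longrightarrow> g \<in> L2 \<Omega> \<Longrightarrow> f - g \<in> L2 \<Omega>"
  using L2_add[of f \<Omega> "- g"] L2_minus[of g \<Omega>] by simp

lemma L2_inner_commute: "L2_inner \<Omega> f g = L2_inner \<Omega> g f"
  by (simp add: L2_inner_def inner_commute)

lemma L2_inner_add_left:
  "f \<in> L2 \<Omega> \<Longrightarrow> g \<in> L2 \<Omega> \<Longrightarrow> h \<in> L2 \<Omega> \<Longrightarrow>
    L2_inner \<Omega> (f + g) h = L2_inner \<Omega> f h + L2_inner \<Omega> g h"
  by (simp add: L2_inner_def inner_add_left L2_integrable_inner)

lemma L2_inner_scaleR_left: "L2_inner \<Omega> (c *\<^sub>R f) h = c * L2_inner \<Omega> f h"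
  by (simp add: L2_inner_def scaleR_fun_def)

lemma L2_inner_minus_left: "L2_inner \<Omega> (- f) h = - L2_inner \<Omega> f h"
  using L2_inner_scaleR_left[of \<Omega> "-1" f h] by simp

lemma L2_inner_diff_left:
  "f \<in> L2 \<Omega> \<Longrightarrow> g \<in> L2 \<Omega> \<Longrightarrow> h \<in> L2 \<Omega> \<Longrightarrow>
    L2_inner \<Omega> (f - g) h = L2_inner \<Omega> f h - L2_inner \<Omega> g h"
  by (simp add: L2_inner_def inner_diff_left L2_integrable_inner)

lemma L2_inner_zero_left [simp]: "L2_inner \<Omega> 0 h = 0"
  by (simp add: L2_inner_def)

lemma L2_inner_add_right:
  "f \<in> L2 \<Omega> \<Longrightarrow> g \<in> L2 \<Omega> \<Longrightarrow> h \<in> L2 \<Omega> \<Longrightarrow>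
    L2_inner \<Omega> h (f + g) = L2_inner \<Omega> h f + L2_inner \<Omega> h g"
  by (metis L2_inner_add_left L2_inner_commute)

lemma L2_inner_scaleR_right: "L2_inner \<Omega> h (c *\<^sub>R f) = c * L2_inner \<Omega> h f"
  by (metis L2_inner_scaleR_left L2_inner_commute)

lemma L2_inner_minus_right: "L2_inner \<Omega> h (- f) = - L2_inner \<Omega> h f"
  by (metis L2_inner_minus_left L2_inner_commute)

lemma L2_inner_diff_right:
  "f \<in> L2 \<Omega> \<Longrightarrow> g \<in> L2 \<Omega> \<Longrightarrow> h \<in> L2 \<Omega> \<Longrightarrow>
    L2_inner \<Omega> h (f - g) = L2_inner \<Omega> h f - L2_inner \<Omega> h g"
  by (metis L2_inner_diff_left L2_inner_commute)

lemma L2_inner_zero_right [simp]: "L2_inner \<Omega> h 0 = 0"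
  by (simp add: L2_inner_def)

lemma L2_inner_AE_cong:
  assumes "AE x in lebesgue_on \<Omega>. f x = f' x" "AE x in lebesgue_on \<Omega>. g x = g' x"
    and "f \<in> L2 \<Omega>" "f' \<in> L2 \<Omega>" "g \<in> L2 \<Omega>" "g' \<in> L2 \<Omega>"
  shows "L2_inner \<Omega> f g = L2_inner \<Omega> f' g'"
  unfolding L2_inner_def
proof (rule integral_cong_AE)
  show "AE x in lebesgue_on \<Omega>. f x \<bullet> g x = f' x \<bullet> g' x"
    using assms(1,2) by eventually_elim simp
qed (use assms(3-) L2_integrable_inner in \<open>blast intro: borel_measurable_integrable\<close>)+

lemma L2_inner_self_nonneg [simp]: "0 \<le> L2_inner \<Omega> f f"
  by (simp add: L2_inner_def)

lemma L2_norm_nonneg [simp]: "0 \<le> L2_norm \<Omega> f"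
  by (simp add: L2_norm_def)

lemma L2_norm_power2: "(L2_norm \<Omega> f)\<^sup>2 = L2_inner \<Omega> f f"
  by (simp add: L2_norm_def)

lemma L2_norm_minus: "L2_norm \<Omega> (- f) = L2_norm \<Omega> f"
  by (simp add: L2_norm_def L2_inner_minus_left L2_inner_minus_right)

lemma L2_norm_AE_cong:
  "AE x in lebesgue_on \<Omega>. f x = g x \<Longrightarrow> f \<in> L2 \<Omega> \<Longrightarrow> g \<in> L2 \<Omega> \<Longrightarrow> L2_norm \<Omega> f = L2_norm \<Omega> g"
  unfolding L2_norm_def by (subst L2_inner_AE_cong[where f' = g and g' = g]) auto

lemma L2_inner_self_eq_0_iff:
  assumes "f \<in> L2 \<Omega>"
  shows "L2_inner \<Omega> f f = 0 \<longleftrightarrow> (AE x in lebesgue_on \<Omega>. f x = 0)"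
  using integral_nonneg_eq_0_iff_AE[of "lebesgue_on \<Omega>" "\<lambda>x. f x \<bullet> f x"]
    L2_integrable_inner[OF assms assms]
  by (simp add: L2_inner_def)

lemma L2_Cauchy_Schwarz:
  assumes "f \<in> L2 \<Omega>" "g \<in> L2 \<Omega>"
  shows "\<bar>L2_inner \<Omega> f g\<bar> \<le> L2_norm \<Omega> f * L2_norm \<Omega> g"
proof -
  let ?A = "L2_inner \<Omega> f f" and ?B = "L2_inner \<Omega> f g" and ?C = "L2_inner \<Omega> g g"
  have *: "0 \<le> s\<^sup>2 * ?A + 2 * s * t * ?B + t\<^sup>2 * ?C" for s t
  proof -
    have "0 \<le> L2_inner \<Omega> (s *\<^sub>R f + t *\<^sub>R g) (s *\<^sub>R f + t *\<^sub>R g)"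
      by simp
    also have "\<dots> = s\<^sup>2 * ?A + 2 * s * t * ?B + t\<^sup>2 * ?C"
      using assms
      by (simp add: L2_inner_add_left L2_inner_add_right L2_inner_scaleR_left L2_inner_scaleR_right
          L2_scaleR L2_add L2_inner_commute[of \<Omega> g f] power2_eq_square algebra_simps)
    finally show ?thesis .
  qed
  have "?B\<^sup>2 \<le> ?A * ?C"
  proof (cases "?A = 0 \<and> ?C = 0")
    case True
    then show ?thesis using *[of 1 "-?B"] by (simp add: power2_eq_square)
  next
    case False
    have "0 \<le> ?C * (?A * ?C - ?B\<^sup>2)" "0 \<le> ?A * (?A * ?C - ?B\<^sup>2)"
      using *[of ?C "-?B"] *[of ?B "-?A"] by (auto simp: power2_eq_square algebra_simps)
    moreover have "?A > 0 \<or> ?C > 0"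
      using False L2_inner_self_nonneg[of \<Omega> f] L2_inner_self_nonneg[of \<Omega> g] by linarith
    ultimately show ?thesis
      by (auto simp: zero_le_mult_iff)
  qed
  also have "\<dots> = (L2_norm \<Omega> f * L2_norm \<Omega> g)\<^sup>2"
    by (simp add: power_mult_distrib L2_norm_power2)
  finally show ?thesis
    by (simp add: abs_le_square_iff[symmetric])
qed

lemma L2_norm_add_power2:
  assumes "f \<in> L2 \<Omega>" "g \<in> L2 \<Omega>"
  shows "(L2_norm \<Omega> (f + g))\<^sup>2 = (L2_norm \<Omega> f)\<^sup>2 + 2 * L2_inner \<Omega> f g + (L2_norm \<Omega> g)\<^sup>2"
  using assms
  by (simp add: L2_norm_power2 L2_inner_add_left L2_inner_add_right L2_add L2_inner_commute[of \<Omega> g f])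

lemma L2_norm_diff_power2:
  assumes "f \<in> L2 \<Omega>" "g \<in> L2 \<Omega>"
  shows "(L2_norm \<Omega> (f - g))\<^sup>2 = (L2_norm \<Omega> f)\<^sup>2 - 2 * L2_inner \<Omega> f g + (L2_norm \<Omega> g)\<^sup>2"
  using L2_norm_add_power2[OF assms(1) L2_minus[OF assms(2)]]
  by (simp add: L2_norm_minus L2_inner_minus_right)

lemma L2_norm_triangle:
  assumes "f \<in> L2 \<Omega>" "g \<in> L2 \<Omega>"
  shows "L2_norm \<Omega> (f + g) \<le> L2_norm \<Omega> f + L2_norm \<Omega> g"
proof (rule power2_le_imp_le)
  have "L2_inner \<Omega> f g \<le> L2_norm \<Omega> f * L2_norm \<Omega> g"
    using L2_Cauchy_Schwarz[OF assms] by linarith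
  then show "(L2_norm \<Omega> (f + g))\<^sup>2 \<le> (L2_norm \<Omega> f + L2_norm \<Omega> g)\<^sup>2"
    unfolding L2_norm_add_power2[OF assms] by (simp add: power2_sum)
qed simp

lemma L2_norm_triangle_diff:
  assumes "f \<in> L2 \<Omega>" "g \<in> L2 \<Omega>"
  shows "L2_norm \<Omega> (f - g) \<le> L2_norm \<Omega> f + L2_norm \<Omega> g"
  using L2_norm_triangle[OF assms(1) L2_minus[OF assms(2)]] by (simp add: L2_norm_minus)

lemma L2_inner_tendsto:
  assumes X: "\<And>k. X k \<in> L2 \<Omega>" and F: "F \<in> L2 \<Omega>" and h: "h \<in> L2 \<Omega>"
    and lim: "(\<lambda>k. L2_norm \<Omega> (X k - F)) \<longlonglongrightarrow> 0"
  shows "(\<lambda>k. L2_inner \<Omega> (X k) h) \<longlonglongrightarrow> L2_inner \<Omega> F h"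
proof (rule LIM_zero_cancel, rule tendsto_rabs_zero_cancel, rule tendsto_sandwich[OF _ _ tendsto_const])
  show "\<forall>\<^sub>F k in sequentially. \<bar>L2_inner \<Omega> (X k) h - L2_inner \<Omega> F h\<bar> \<le> L2_norm \<Omega> (X k - F) * L2_norm \<Omega> h"
    using L2_Cauchy_Schwarz[OF L2_diff[OF X F] h] L2_inner_diff_left[OF X F h] by auto
  show "(\<lambda>k. L2_norm \<Omega> (X k - F) * L2_norm \<Omega> h) \<longlonglongrightarrow> 0"
    using tendsto_mult_right[OF lim, of "L2_norm \<Omega> h"] by simp
qed auto

lemma nn_integral_norm_square_L2:
  assumes "f \<in> L2 \<Omega>"
  shows "(\<integral>\<^sup>+ x. ennreal ((norm (f x))\<^sup>2) \<partial>lebesgue_on \<Omega>) = ennreal ((L2_norm \<Omega> f)\<^sup>2)"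
  using assms unfolding L2_norm_power2 L2_inner_def
  by (subst nn_integral_eq_integral) (auto simp: L2_def power2_norm_eq_inner)

text \<open>Riesz and Fischer: along a subsequence whose increments \<open>d\<^sub>k\<close> have norm at most \<open>4\<^sup>-\<^sup>k\<close>,
  the series of the \<open>4\<^sup>k d\<^sub>k\<^sup>2\<close> is integrable, so that almost everywhere \<open>d\<^sub>k\<close> is
  dominated by a geometric series. This gives a pointwise limit, and Fatou's lemma turns it into a
  limit in norm.\<close>

lemma L2_complete:
  fixes X :: "nat \<Rightarrow> 'a::euclidean_space \<Rightarrow> 'b::euclidean_space"
  assumes X: "\<And>k. X k \<in> L2 \<Omega>"
    and Cauchy: "\<And>e. e > 0 \<Longrightarrow> \<exists>N. \<forall>m\<ge>N. \<forall>n\<ge>N. L2_norm \<Omega> (X m - X n) < e"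
  shows "\<exists>F\<in>L2 \<Omega>. (\<lambda>k. L2_norm \<Omega> (X k - F)) \<longlonglongrightarrow> 0"
proof -
  define N where "N k = (SOME N. \<forall>m\<ge>N. \<forall>n\<ge>N. L2_norm \<Omega> (X m - X n) < (1/4)^k)" for k
  have N: "L2_norm \<Omega> (X m - X n) < (1/4)^k" if "m \<ge> N k" "n \<ge> N k" for m n k
  proof -
    have "\<exists>N. \<forall>m\<ge>N. \<forall>n\<ge>N. L2_norm \<Omega> (X m - X n) < (1/4)^k"
      by (rule Cauchy) simp
    from someI_ex[OF this] that show ?thesis unfolding N_def by blast
  qed
  define r where "r k = (\<Sum>i\<le>k. N i) + k" for k
  have r_ge: "r k \<ge> N k" "r k \<ge> k" for k
    unfolding r_def by (auto intro: trans_le_add1 member_le_sum)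
  have r_Suc: "r (Suc k) \<ge> r k" for k
    unfolding r_def by simp
  define Y where "Y k = X (r k)" for k
  have Y: "Y k \<in> L2 \<Omega>" for k unfolding Y_def by (rule X)
  define d where "d k x = norm (Y (Suc k) x - Y k x)" for k x
  have term_le_suminf: "h k \<le> (\<Sum>k. h k)" for h :: "nat \<Rightarrow> ennreal" and k
    using sum_le_suminf[of h "{k}"] by simp
  have finite_ennrealE: "\<exists>c\<ge>0. s = ennreal c" if "s \<noteq> \<infinity>" for s
    using that by (cases s) auto
  have d_meas [measurable]: "d k \<in> borel_measurable (lebesgue_on \<Omega>)" for k
    unfolding d_def using Y[THEN L2_measurable] by measurable
  have d_int: "(\<integral>\<^sup>+ x. ennreal (4^k * (d k x)\<^sup>2) \<partial>lebesgue_on \<Omega>) \<le> ennreal ((1/4)^k)" for k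
  proof -
    have "(\<integral>\<^sup>+ x. ennreal (4^k * (d k x)\<^sup>2) \<partial>lebesgue_on \<Omega>)
        = ennreal (4^k) * (\<integral>\<^sup>+ x. ennreal ((d k x)\<^sup>2) \<partial>lebesgue_on \<Omega>)"
      by (simp add: ennreal_mult nn_integral_cmult)
    also have "(\<integral>\<^sup>+ x. ennreal ((d k x)\<^sup>2) \<partial>lebesgue_on \<Omega>) = ennreal ((L2_norm \<Omega> (Y (Suc k) - Y k))\<^sup>2)"
      using nn_integral_norm_square_L2[OF L2_diff[OF Y Y]] by (simp add: d_def)
    also have "ennreal (4^k) * \<dots> = ennreal (4^k * (L2_norm \<Omega> (Y (Suc k) - Y k))\<^sup>2)"
      by (simp add: ennreal_mult)
    also have "\<dots> \<le> ennreal (4^k * ((1/4)^k)\<^sup>2)"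
    proof (intro ennreal_leI mult_left_mono power_mono)
      show "L2_norm \<Omega> (Y (Suc k) - Y k) \<le> (1/4)^k"
        unfolding Y_def using N[of k "r (Suc k)" "r k"] r_ge[of k] r_Suc[of k] by force
    qed auto
    also have "4^k * ((1/4)^k)\<^sup>2 = ((1/4)^k :: real)"
      by (simp add: power2_eq_square power_divide field_simps)
    finally show ?thesis .
  qed
  have "(\<integral>\<^sup>+ x. (\<Sum>k. ennreal (4^k * (d k x)\<^sup>2)) \<partial>lebesgue_on \<Omega>) \<le> (\<Sum>k. ennreal ((1/4)^k))"
    by (subst nn_integral_suminf) (auto intro!: suminf_le d_int)
  also have "\<dots> = ennreal (\<Sum>k. (1/4)^k)"
    by (rule suminf_ennreal2) (auto intro!: summable_geometric)
  also have "\<dots> < \<infinity>" by simp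
  finally have fin: "(\<integral>\<^sup>+ x. (\<Sum>k. ennreal (4^k * (d k x)\<^sup>2)) \<partial>lebesgue_on \<Omega>) \<noteq> \<infinity>"
    by simp
  have "AE x in lebesgue_on \<Omega>. (\<Sum>k. ennreal (4^k * (d k x)\<^sup>2)) \<noteq> \<infinity>"
    by (rule nn_integral_PInf_AE[OF _ fin]) measurable
  then have conv: "AE x in lebesgue_on \<Omega>. convergent (\<lambda>k. Y k x)"
  proof eventually_elim
    case (elim x)
    from finite_ennrealE[OF this] obtain c
      where c: "c \<ge> 0" "(\<Sum>k. ennreal (4^k * (d k x)\<^sup>2)) = ennreal c"
      by blast
    have "d k x \<le> sqrt c * (1/2)^k" for k
    proof -
      have "ennreal (4^k * (d k x)\<^sup>2) \<le> ennreal c"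
        unfolding c(2)[symmetric] by (rule term_le_suminf)
      then have "4^k * (d k x)\<^sup>2 \<le> c" using c(1) by simp
      moreover have "(4::real)^k = (2^k)\<^sup>2" by (simp add: power2_eq_square flip: power_mult_distrib)
      ultimately have "(2^k * d k x)\<^sup>2 \<le> c" by (simp add: power_mult_distrib)
      then have "2^k * d k x \<le> sqrt c" by (rule real_le_rsqrt)
      then show ?thesis by (simp add: field_simps)
    qed
    then have "norm (Y (Suc k) x - Y k x) \<le> sqrt c * (1/2)^k" for k
      unfolding d_def .
    moreover have "summable (\<lambda>k. sqrt c * (1/2)^k)"
      by (rule summable_mult) (simp add: summable_geometric)
    ultimately have "summable (\<lambda>k. Y (Suc k) x - Y k x)"
      by (rule summable_comparison_test'[where N = 0, rotated])
    from summable_sums[OF this] have "convergent (\<lambda>n. \<Sum>k<n. Y (Suc k) x - Y k x)"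
      unfolding sums_def convergent_def by blast
    then have "convergent (\<lambda>n. Y n x - Y 0 x)"
      unfolding sum_lessThan_telescope[where f = "\<lambda>k. Y k x"] .
    then have "convergent (\<lambda>n. (Y n x - Y 0 x) + Y 0 x)"
      using convergent_const by (rule convergent_add)
    then show ?case by simp
  qed
  define F where "F x = lim (\<lambda>k. Y k x)" for x
  have F_meas: "F \<in> borel_measurable (lebesgue_on \<Omega>)"
    unfolding F_def using Y[THEN L2_measurable] by (rule borel_measurable_lim_metric)
  have F_lim: "AE x in lebesgue_on \<Omega>. (\<lambda>k. Y k x) \<longlonglongrightarrow> F x"
    using conv by eventually_elim (simp add: F_def convergent_LIMSEQ_iff)
  have Fatou: "(\<integral>\<^sup>+ x. ennreal ((norm (X n x - F x))\<^sup>2) \<partial>lebesgue_on \<Omega>) \<le> ennreal (e\<^sup>2)"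
    if e: "\<forall>m\<ge>M. L2_norm \<Omega> (X n - X m) \<le> e" for n e M
  proof -
    have "(\<integral>\<^sup>+ x. ennreal ((norm (X n x - F x))\<^sup>2) \<partial>lebesgue_on \<Omega>)
        = (\<integral>\<^sup>+ x. liminf (\<lambda>k. ennreal ((norm (X n x - Y k x))\<^sup>2)) \<partial>lebesgue_on \<Omega>)"
    proof (rule nn_integral_cong_AE)
      show "AE x in lebesgue_on \<Omega>. ennreal ((norm (X n x - F x))\<^sup>2)
          = liminf (\<lambda>k. ennreal ((norm (X n x - Y k x))\<^sup>2))"
        using F_lim
      proof eventually_elim
        case (elim x)
        have "(\<lambda>k. ennreal ((norm (X n x - Y k x))\<^sup>2)) \<longlonglongrightarrow> ennreal ((norm (X n x - F x))\<^sup>2)"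
          by (intro tendsto_intros elim)
        from lim_imp_Liminf[OF sequentially_bot this] show ?case by simp
      qed
    qed
    also have "\<dots> \<le> liminf (\<lambda>k. \<integral>\<^sup>+ x. ennreal ((norm (X n x - Y k x))\<^sup>2) \<partial>lebesgue_on \<Omega>)"
    proof (rule nn_integral_liminf)
      show "(\<lambda>x. ennreal ((norm (X n x - Y k x))\<^sup>2)) \<in> borel_measurable (lebesgue_on \<Omega>)" for k
        using Y[THEN L2_measurable] X[THEN L2_measurable] by measurable
    qed
    also have "\<dots> = liminf (\<lambda>k. ennreal ((L2_norm \<Omega> (X n - Y k))\<^sup>2))"
      using nn_integral_norm_square_L2[OF L2_diff[OF X Y]] by simp
    also have "\<dots> \<le> ennreal (e\<^sup>2)"
    proof (rule Liminf_le)
      show "\<forall>\<^sub>F k in sequentially. ennreal ((L2_norm \<Omega> (X n - Y k))\<^sup>2) \<le> ennreal (e\<^sup>2)"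
      proof (rule eventually_sequentiallyI[of M])
        fix k assume "M \<le> k"
        then have "L2_norm \<Omega> (X n - Y k) \<le> e"
          unfolding Y_def using e r_ge(2)[of k] by (meson order_trans)
        then show "ennreal ((L2_norm \<Omega> (X n - Y k))\<^sup>2) \<le> ennreal (e\<^sup>2)"
          by (intro ennreal_leI power_mono) auto
      qed
    qed simp
    finally show ?thesis .
  qed
  have diff_L2: "X n - F \<in> L2 \<Omega>" if "\<forall>m\<ge>M. L2_norm \<Omega> (X n - X m) \<le> e" for n e M
  proof -
    have "integrable (lebesgue_on \<Omega>) (\<lambda>x. (norm (X n x - F x))\<^sup>2)"
    proof (rule integrableI_bounded)
      show "(\<lambda>x. (norm (X n x - F x))\<^sup>2) \<in> borel_measurable (lebesgue_on \<Omega>)"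
        using X[THEN L2_measurable] F_meas by measurable
      show "(\<integral>\<^sup>+ x. ennreal (norm ((norm (X n x - F x))\<^sup>2)) \<partial>lebesgue_on \<Omega>) < \<infinity>"
        using Fatou[OF that] by (simp add: order.strict_trans1)
    qed
    moreover have "(\<lambda>x. X n x - F x) \<in> borel_measurable (lebesgue_on \<Omega>)"
      using X[THEN L2_measurable] F_meas by measurable
    ultimately show ?thesis by (simp add: L2_def fun_diff_def)
  qed
  obtain M1 where "\<forall>m\<ge>M1. \<forall>n\<ge>M1. L2_norm \<Omega> (X m - X n) < 1"
    using Cauchy[of 1] by auto
  then have "X M1 - F \<in> L2 \<Omega>"
    by (intro diff_L2[of M1 M1 1]) (auto intro: less_imp_le)
  from L2_diff[OF X this, of M1] have F: "F \<in> L2 \<Omega>" by simp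
  have "(\<lambda>k. L2_norm \<Omega> (X k - F)) \<longlonglongrightarrow> 0"
  proof (rule LIMSEQ_I)
    fix e :: real assume "e > 0"
    then obtain M where M: "\<forall>m\<ge>M. \<forall>n\<ge>M. L2_norm \<Omega> (X m - X n) < e/2"
      using Cauchy[of "e/2"] by auto
    have "norm (L2_norm \<Omega> (X n - F) - 0) < e" if "n \<ge> M" for n
    proof -
      have near: "\<forall>m\<ge>M. L2_norm \<Omega> (X n - X m) \<le> e/2"
        using M that by (meson less_imp_le)
      have "ennreal ((L2_norm \<Omega> (X n - F))\<^sup>2) \<le> ennreal ((e/2)\<^sup>2)"
        using nn_integral_norm_square_L2[OF L2_diff[OF X F], of n] Fatou[of M n "e/2"] near
        by simp
      then have "(L2_norm \<Omega> (X n - F))\<^sup>2 \<le> (e/2)\<^sup>2"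
        by (simp only: ennreal_le_iff zero_le_power2)
      then have "L2_norm \<Omega> (X n - F) \<le> e/2"
        by (rule power2_le_imp_le) (use \<open>e > 0\<close> in simp)
      then show ?thesis using \<open>e > 0\<close> by simp
    qed
    then show "\<exists>no. \<forall>n\<ge>no. norm (L2_norm \<Omega> (X n - F) - 0) < e" by blast
  qed
  with F show ?thesis by blast
qed

text \<open>The orthogonal projection onto the closure of a subspace: a minimising sequence for the
  distance is Cauchy by the parallelogram law, and the residual of its limit is orthogonal.\<close>

lemma L2_projection:
  fixes W :: "'a::euclidean_space \<Rightarrow> 'b::euclidean_space"
  assumes V: "V \<subseteq> L2 \<Omega>" "0 \<in> V"
    and add: "\<And>v w. v \<in> V \<Longrightarrow> w \<in> V \<Longrightarrow> v + w \<in> V"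
    and scale: "\<And>c v. v \<in> V \<Longrightarrow> c *\<^sub>R v \<in> V"
    and W: "W \<in> L2 \<Omega>"
  obtains X P where "\<And>k. X k \<in> V" "P \<in> L2 \<Omega>" "(\<lambda>k::nat. L2_norm \<Omega> (X k - P)) \<longlonglongrightarrow> 0"
    "\<And>v. v \<in> V \<Longrightarrow> L2_inner \<Omega> (W - P) v = 0"
proof -
  define D where "D v = (L2_norm \<Omega> (W - v))\<^sup>2" for v
  define \<delta> where "\<delta> = (INF v\<in>V. D v)"
  have bdd: "bdd_below (D ` V)" by (rule bdd_belowI[of _ 0]) (auto simp: D_def)
  have \<delta>_le: "\<delta> \<le> D v" if "v \<in> V" for v
    unfolding \<delta>_def using bdd that by (rule cINF_lower)
  have "\<exists>v\<in>V. D v < \<delta> + 1 / (real k + 1)" for k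
  proof -
    have "\<delta> < \<delta> + 1 / (real k + 1)" by simp
    then show ?thesis unfolding \<delta>_def using V(2) bdd by (subst (asm) cINF_less_iff) auto
  qed
  then obtain X where XV: "\<And>k. X k \<in> V" and XD: "\<And>k. D (X k) < \<delta> + 1 / (real k + 1)"
    by metis
  have X: "X k \<in> L2 \<Omega>" for k using XV V(1) by blast
  have gap: "(L2_norm \<Omega> (X m - X n))\<^sup>2 \<le> 2 / (real m + 1) + 2 / (real n + 1)" for m n
  proof -
    define Z where "Z = (1/2) *\<^sub>R (X m + X n)"
    have "Z \<in> V" unfolding Z_def by (intro scale add XV)
    let ?p = "W - X m" and ?q = "W - X n"
    have pq: "?p \<in> L2 \<Omega>" "?q \<in> L2 \<Omega>" using W X by auto
    have e1: "?q - ?p = X m - X n" by simp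
    have e2: "W - Z = (1/2) *\<^sub>R (?p + ?q)"
      by (auto simp: Z_def fun_eq_iff scaleR_fun_def algebra_simps simp flip: scaleR_add_left)
    have "4 * D Z = (L2_norm \<Omega> (?p + ?q))\<^sup>2"
      unfolding D_def e2 L2_norm_power2 by (simp add: L2_inner_scaleR_left L2_inner_scaleR_right)
    moreover have "(L2_norm \<Omega> (?q - ?p))\<^sup>2 + (L2_norm \<Omega> (?p + ?q))\<^sup>2 = 2 * D (X m) + 2 * D (X n)"
      unfolding D_def L2_norm_add_power2[OF pq] L2_norm_diff_power2[OF pq(2,1)]
      by (simp add: L2_inner_commute[of \<Omega> ?q ?p])
    ultimately have "(L2_norm \<Omega> (X m - X n))\<^sup>2 = 2 * D (X m) + 2 * D (X n) - 4 * D Z"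
      unfolding e1 by linarith
    moreover have "2 * (1 / (real k + 1)) = 2 / (real k + 1)" for k by simp
    ultimately show ?thesis using \<delta>_le[OF \<open>Z \<in> V\<close>] XD[of m] XD[of n] by smt
  qed
  have "\<exists>N. \<forall>m\<ge>N. \<forall>n\<ge>N. L2_norm \<Omega> (X m - X n) < e" if "e > 0" for e
  proof -
    obtain N where N: "4 / e\<^sup>2 < real N" using reals_Archimedean2 by blast
    have "L2_norm \<Omega> (X m - X n) < e" if mn: "m \<ge> N" "n \<ge> N" for m n
    proof (rule power2_less_imp_less)
      have "2 / (real k + 1) < e\<^sup>2 / 2" if "k \<ge> N" for k
      proof -
        have "4 / e\<^sup>2 < real k + 1" using N that by linarith
        then show ?thesis using \<open>e > 0\<close> by (simp add: field_simps)
      qed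
      from this[OF mn(1)] this[OF mn(2)] gap[of m n]
      show "(L2_norm \<Omega> (X m - X n))\<^sup>2 < e\<^sup>2" by linarith
    qed (use \<open>e > 0\<close> in simp)
    then show ?thesis by blast
  qed
  from L2_complete[OF X this] obtain P where P: "P \<in> L2 \<Omega>" "(\<lambda>k. L2_norm \<Omega> (X k - P)) \<longlonglongrightarrow> 0"
    by blast
  have orth: "L2_inner \<Omega> (W - P) v = 0" if v: "v \<in> V" for v
  proof -
    have vL: "v \<in> L2 \<Omega>" using v V by blast
    let ?A = "L2_inner \<Omega> v v" and ?B = "L2_inner \<Omega> (W - P) v"
    have B: "(\<lambda>k. L2_inner \<Omega> (W - X k) v) \<longlonglongrightarrow> ?B"
    proof -
      have "(\<lambda>k. L2_inner \<Omega> W v - L2_inner \<Omega> (X k) v) \<longlonglongrightarrow> L2_inner \<Omega> W v - L2_inner \<Omega> P v"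
        by (intro tendsto_intros L2_inner_tendsto X P vL)
      then show ?thesis using W X P(1) vL by (simp add: L2_inner_diff_left)
    qed
    have key: "2 * t * ?B \<le> t\<^sup>2 * ?A" for t
    proof (rule LIMSEQ_le)
      show "(\<lambda>k. 2 * t * L2_inner \<Omega> (W - X k) v) \<longlonglongrightarrow> 2 * t * ?B"
        by (intro tendsto_intros B)
      have "(\<lambda>k. 1 / (real k + 1)) \<longlonglongrightarrow> 0"
        using LIMSEQ_inverse_real_of_nat by (simp add: inverse_eq_divide add.commute)
      from tendsto_add[OF this tendsto_const[of "t\<^sup>2 * ?A"]]
      show "(\<lambda>k. 1 / (real k + 1) + t\<^sup>2 * ?A) \<longlonglongrightarrow> t\<^sup>2 * ?A" by simp
      have "2 * t * L2_inner \<Omega> (W - X k) v \<le> 1 / (real k + 1) + t\<^sup>2 * ?A" for k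
      proof -
        have "X k + t *\<^sub>R v \<in> V" by (intro add scale XV v)
        from \<delta>_le[OF this] have "\<delta> \<le> D (X k + t *\<^sub>R v)" .
        also have "\<dots> = (L2_norm \<Omega> ((W - X k) - t *\<^sub>R v))\<^sup>2"
          unfolding D_def by (simp add: algebra_simps)
        also have "\<dots> = D (X k) - 2 * t * L2_inner \<Omega> (W - X k) v + t\<^sup>2 * ?A"
        proof -
          have "(L2_norm \<Omega> (t *\<^sub>R v))\<^sup>2 = t\<^sup>2 * ?A"
            unfolding L2_norm_power2
            by (simp add: L2_inner_scaleR_left L2_inner_scaleR_right power2_eq_square)
          then show ?thesis
            unfolding D_def L2_norm_diff_power2[OF L2_diff[OF W X] L2_scaleR[OF vL]]
            by (simp add: L2_inner_scaleR_right)
        qed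
        finally show ?thesis using XD[of k] by linarith
      qed
      then show "\<exists>N. \<forall>k\<ge>N. 2 * t * L2_inner \<Omega> (W - X k) v \<le> 1 / (real k + 1) + t\<^sup>2 * ?A"
        by blast
    qed
    show ?thesis
    proof (rule ccontr)
      assume "?B \<noteq> 0"
      \<comment> \<open>For \<open>t = B / (A + 1)\<close> the inequality reads \<open>2 (A + 1) \<le> A\<close> up to a positive factor.\<close>
      have "A1 > 0 \<Longrightarrow> 2 * (?B / A1) * ?B \<le> (?B / A1)\<^sup>2 * ?A \<Longrightarrow> 2 * A1 * ?B\<^sup>2 \<le> ?A * ?B\<^sup>2" for A1
        by (simp add: field_simps power2_eq_square)
      from this[of "?A + 1", OF _ key] have "2 * (?A + 1) \<le> ?A"
        using \<open>?B \<noteq> 0\<close> L2_inner_self_nonneg[of \<Omega> v] by (simp add: mult_le_cancel_right)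
      then show False using L2_inner_self_nonneg[of \<Omega> v] by simp
    qed
  qed
  show thesis using that[OF XV P orth] .
qed


section \<open>Smooth bump functions\<close>

lemma C_times_of_derivative_closed:
  assumes "\<And>f. f \<in> S \<Longrightarrow> f differentiable_on UNIV"
    and "\<And>f i. f \<in> S \<Longrightarrow> i \<in> Basis \<Longrightarrow> partial_deriv i f \<in> S"
    and "f \<in> S"
  shows "C_times k f"
  using assms(3)
proof (induction k arbitrary: f)
  case 0
  then show ?case using assms(1) differentiable_imp_continuous_on by auto
next
  case (Suc k)
  then show ?case using assms(1,2) by auto
qed

text \<open>The functions \<open>t\<^sup>-\<^sup>m exp (- 1 / t)\<close>, extended by zero to \<open>t \<le> 0\<close>: their linear span is closed
  under differentiation, which is how \<open>exp (- 1 / t)\<close> is seen to be smooth at zero.\<close>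
definition flat_exp :: "nat \<Rightarrow> real \<Rightarrow> real" where
  "flat_exp m t = (if t > 0 then exp (- 1 / t) / t ^ m else 0)"

lemma flat_exp_nonneg: "0 \<le> flat_exp m t"
  by (simp add: flat_exp_def)

lemma flat_exp_has_derivative_0: "(flat_exp m has_real_derivative 0) (at 0)"
proof -
  have "((\<lambda>h. flat_exp m h / h) \<longlongrightarrow> 0) (at 0)"
  proof (rule filterlim_split_at)
    have "\<forall>\<^sub>F h in at_left 0. 0 = flat_exp m h / h"
      by (auto simp: eventually_at_left_field flat_exp_def intro!: exI[of _ "-1"])
    then show "((\<lambda>h. flat_exp m h / h) \<longlongrightarrow> 0) (at_left 0)"
      by (rule Lim_transform_eventually[OF tendsto_const])
    have "\<forall>\<^sub>F h in at_right 0. inverse h ^ Suc m / exp (inverse h) = flat_exp m h / h"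
      using eventually_at_right_less[of "0::real"]
      by eventually_elim (auto simp: flat_exp_def field_simps exp_minus)
    moreover have "((\<lambda>h. inverse h ^ Suc m / exp (inverse h)) \<longlongrightarrow> (0::real)) (at_right 0)"
      by (rule filterlim_compose[OF tendsto_power_div_exp_0 filterlim_inverse_at_top_right])
    ultimately show "((\<lambda>h. flat_exp m h / h) \<longlongrightarrow> 0) (at_right 0)"
      by (rule Lim_transform_eventually[rotated])
  qed
  then show ?thesis
    by (simp add: has_field_derivative_iff flat_exp_def)
qed

lemma flat_exp_has_derivative:
  "(flat_exp m has_real_derivative flat_exp (m + 2) t - m * flat_exp (m + 1) t) (at t)"
proof (cases t "0::real" rule: linorder_cases)
  case less
  have "((\<lambda>t. 0) has_real_derivative 0) (at t)" by simp
  then have "(flat_exp m has_real_derivative 0) (at t)"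
    by (rule has_field_derivative_transform_within_open[where S = "{..<0}"])
      (use less in \<open>auto simp: flat_exp_def\<close>)
  then show ?thesis using less by (simp add: flat_exp_def)
next
  case equal
  then show ?thesis using flat_exp_has_derivative_0[of m] by (simp add: flat_exp_def)
next
  case greater
  have "((\<lambda>t. exp (- 1 / t) / t ^ m) has_real_derivative
      (exp (- 1 / t) * (1 / t\<^sup>2) * t ^ m - exp (- 1 / t) * (real m * t ^ (m - 1))) / (t ^ m * t ^ m)) (at t)"
    using greater by (auto intro!: derivative_eq_intros simp: power2_eq_square)
  also have "(exp (- 1 / t) * (1 / t\<^sup>2) * t ^ m - exp (- 1 / t) * (real m * t ^ (m - 1))) / (t ^ m * t ^ m)
      = flat_exp (m + 2) t - m * flat_exp (m + 1) t"
    using greater by (cases m) (simp_all add: flat_exp_def field_simps power2_eq_square)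
  finally have "((\<lambda>t. exp (- 1 / t) / t ^ m) has_real_derivative
      flat_exp (m + 2) t - m * flat_exp (m + 1) t) (at t)" .
  then show ?thesis
    by (rule has_field_derivative_transform_within_open[where S = "{0<..}"])
      (use greater in \<open>auto simp: flat_exp_def\<close>)
qed

text \<open>An algebra of functions that contains the bumps and is closed under partial derivatives.\<close>
inductive_set flat_exp_algebra :: "('a::euclidean_space \<Rightarrow> real) set" where
  const: "(\<lambda>x. r) \<in> flat_exp_algebra"
| flat_exp: "(\<lambda>x. flat_exp m (c \<bullet> x + d)) \<in> flat_exp_algebra"
| add: "f \<in> flat_exp_algebra \<Longrightarrow> g \<in> flat_exp_algebra \<Longrightarrow> (\<lambda>x. f x + g x) \<in> flat_exp_algebra"
| mult: "f \<in> flat_exp_algebra \<Longrightarrow> g \<in> flat_exp_algebra \<Longrightarrow> (\<lambda>x. f x * g x) \<in> flat_exp_algebra"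

lemma flat_exp_algebra_prod:
  "(\<And>i. i \<in> I \<Longrightarrow> f i \<in> flat_exp_algebra) \<Longrightarrow> (\<lambda>x. \<Prod>i\<in>I. f i x) \<in> flat_exp_algebra"
  by (induction I rule: infinite_finite_induct) (auto intro: flat_exp_algebra.intros)

lemma flat_exp_algebra_derivative:
  assumes "f \<in> flat_exp_algebra"
  shows "\<exists>D. (\<forall>x. (f has_derivative D x) (at x)) \<and> (\<forall>i. (\<lambda>x. D x i) \<in> flat_exp_algebra)"
  using assms
proof induction
  case (const r)
  show ?case
    by (rule exI[of _ "\<lambda>x i. 0"]) (auto intro: flat_exp_algebra.intros)
next
  case (flat_exp m c d)
  show ?case
  proof (intro exI conjI allI)
    fix x
    have "((\<lambda>x. c \<bullet> x + d) has_derivative (\<lambda>h. c \<bullet> h)) (at x)"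
      by (auto intro!: derivative_eq_intros)
    from has_derivative_compose[OF this
        flat_exp_has_derivative[of m "c \<bullet> x + d", unfolded has_field_derivative_def]]
    show "((\<lambda>x. flat_exp m (c \<bullet> x + d)) has_derivative
        (\<lambda>h. (flat_exp (m + 2) (c \<bullet> x + d) + (- real m) * flat_exp (m + 1) (c \<bullet> x + d)) * (c \<bullet> h))) (at x)"
      by simp
  next
    fix i
    show "(\<lambda>x. (flat_exp (m + 2) (c \<bullet> x + d) + (- real m) * flat_exp (m + 1) (c \<bullet> x + d)) * (c \<bullet> i))
        \<in> flat_exp_algebra"
      by (intro flat_exp_algebra.intros)
  qed
next
  case (add f g)
  then obtain D E where
    "\<And>x. (f has_derivative D x) (at x)" "\<And>i. (\<lambda>x. D x i) \<in> flat_exp_algebra"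
    "\<And>x. (g has_derivative E x) (at x)" "\<And>i. (\<lambda>x. E x i) \<in> flat_exp_algebra"
    by metis
  then show ?case
    by (intro exI[of _ "\<lambda>x i. D x i + E x i"])
      (auto intro: has_derivative_add flat_exp_algebra.intros)
next
  case (mult f g)
  then obtain D E where
    "\<And>x. (f has_derivative D x) (at x)" "\<And>i. (\<lambda>x. D x i) \<in> flat_exp_algebra"
    "\<And>x. (g has_derivative E x) (at x)" "\<And>i. (\<lambda>x. E x i) \<in> flat_exp_algebra"
    by metis
  with mult.hyps show ?case
    by (intro exI[of _ "\<lambda>x i. f x * E x i + D x i * g x"])
      (auto intro!: has_derivative_mult flat_exp_algebra.intros)
qed

lemma partial_deriv_eq: "(f has_derivative D) (at x) \<Longrightarrow> partial_deriv i f x = D i"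
  unfolding partial_deriv_def using frechet_derivative_at by metis

lemma flat_exp_algebra_C_times:
  assumes "f \<in> flat_exp_algebra"
  shows "C_times k f"
proof (rule C_times_of_derivative_closed[OF _ _ assms])
  fix f :: "'a \<Rightarrow> real" and i :: 'a assume "f \<in> flat_exp_algebra"
  then obtain D where D: "\<And>x. (f has_derivative D x) (at x)"
      "\<And>i. (\<lambda>x. D x i) \<in> flat_exp_algebra"
    using flat_exp_algebra_derivative by blast
  show "f differentiable_on UNIV"
    using D(1) by (auto simp: differentiable_on_def differentiable_def)
  have "partial_deriv i f = (\<lambda>x. D x i)"
    using partial_deriv_eq[OF D(1)] by blast
  then show "partial_deriv i f \<in> flat_exp_algebra" using D(2) by simp
qed

text \<open>As \<open>k\<close> grows, this increases to the indicator of \<open>box a b\<close>. The arguments \<open>k (x - a)\<close> and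
  \<open>k (b - x)\<close> are spelt in the affine form of the generators of \<open>flat_exp_algebra\<close>.\<close>
definition box_bump :: "'a \<Rightarrow> 'a \<Rightarrow> real \<Rightarrow> 'a::euclidean_space \<Rightarrow> real" where
  "box_bump a b k x =
     (\<Prod>i\<in>Basis. flat_exp 0 ((k *\<^sub>R i) \<bullet> x + (- k * (a \<bullet> i))) * flat_exp 0 ((- k *\<^sub>R i) \<bullet> x + k * (b \<bullet> i)))"

lemma box_bump_in_flat_exp_algebra: "box_bump a b k \<in> flat_exp_algebra"
  unfolding box_bump_def[abs_def] by (intro flat_exp_algebra_prod flat_exp_algebra.intros)

lemma box_bump_eq_0:
  assumes "k > 0" "x \<notin> box a b"
  shows "box_bump a b k x = 0"
proof -
  obtain i where i: "i \<in> Basis" "x \<bullet> i \<le> a \<bullet> i \<or> b \<bullet> i \<le> x \<bullet> i"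
    using assms(2) by (auto simp: mem_box not_less)
  then have "k * (x \<bullet> i) \<le> k * (a \<bullet> i) \<or> k * (b \<bullet> i) \<le> k * (x \<bullet> i)"
    using assms(1) by simp
  then show ?thesis
    unfolding box_bump_def using i(1)
    by (intro prod_zero bexI[of _ i]) (auto simp: flat_exp_def inner_commute)
qed

lemma box_bump_le_1: "\<bar>box_bump a b k x\<bar> \<le> 1"
proof -
  have "flat_exp 0 t \<le> 1" for t by (simp add: flat_exp_def)
  then show ?thesis
    unfolding box_bump_def abs_prod abs_mult
    by (intro prod_le_1 conjI mult_nonneg_nonneg mult_le_one) (auto simp: flat_exp_nonneg)
qed

lemma box_bump_tendsto:
  "(\<lambda>n. box_bump a b (real (Suc n)) x) \<longlonglongrightarrow> indicator (box a b) x"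
proof (cases "x \<in> box a b")
  case True
  have lim: "(\<lambda>n. flat_exp 0 (real (Suc n) * t)) \<longlonglongrightarrow> 1" if "t > 0" for t
  proof -
    have "(\<lambda>n. - (inverse t * inverse (real (Suc n)))) \<longlonglongrightarrow> - (inverse t * 0)"
      by (intro tendsto_intros LIMSEQ_inverse_real_of_nat)
    then have "(\<lambda>n. exp (- (inverse t * inverse (real (Suc n))))) \<longlonglongrightarrow> exp 0"
      by (intro tendsto_exp) simp
    then show ?thesis
      using that by (simp add: flat_exp_def divide_inverse mult.commute)
  qed
  have "(\<lambda>n. box_bump a b (real (Suc n)) x) \<longlonglongrightarrow> (\<Prod>i\<in>(Basis::'a set). 1 * 1)"
    unfolding box_bump_def
  proof (intro tendsto_prod tendsto_mult)
    fix i :: 'a assume i: "i \<in> Basis"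
    have e: "(real (Suc n) *\<^sub>R i) \<bullet> x + (- real (Suc n) * (a \<bullet> i)) = real (Suc n) * (x \<bullet> i - a \<bullet> i)"
      "(- real (Suc n) *\<^sub>R i) \<bullet> x + real (Suc n) * (b \<bullet> i) = real (Suc n) * (b \<bullet> i - x \<bullet> i)" for n
      by (simp_all add: inner_commute algebra_simps)
    show "(\<lambda>n. flat_exp 0 ((real (Suc n) *\<^sub>R i) \<bullet> x + (- real (Suc n) * (a \<bullet> i)))) \<longlonglongrightarrow> 1"
      unfolding e by (rule lim) (use True i in \<open>simp add: mem_box\<close>)
    show "(\<lambda>n. flat_exp 0 ((- real (Suc n) *\<^sub>R i) \<bullet> x + real (Suc n) * (b \<bullet> i))) \<longlonglongrightarrow> 1"
      unfolding e by (rule lim) (use True i in \<open>simp add: mem_box\<close>)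
  qed
  with True show ?thesis by simp
next
  case False
  then show ?thesis by (simp add: box_bump_eq_0)
qed

lemma box_bump_test_function:
  assumes "k > 0" "cbox a b \<subseteq> \<Omega>"
  shows "box_bump a b k \<in> test_functions \<Omega>"
proof -
  have "box_bump a b k x = 0" if "x \<notin> cbox a b" for x
    using box_bump_eq_0[OF assms(1)] that box_subset_cbox by blast
  then have "\<exists>S. compact S \<and> S \<subseteq> \<Omega> \<and> (\<forall>x. x \<notin> S \<longrightarrow> box_bump a b k x = 0)"
    using assms(2) by (intro exI[of _ "cbox a b"]) simp
  then show ?thesis
    unfolding test_functions_def
    by (simp add: flat_exp_algebra_C_times[OF box_bump_in_flat_exp_algebra])
qed


section \<open>Test functions and integration by parts\<close>

lemma integrable_continuous_compact_support:
  fixes f :: "'a::euclidean_space \<Rightarrow> real"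
  assumes "continuous_on UNIV f" "compact S" "\<And>x. x \<notin> S \<Longrightarrow> f x = 0"
  shows "integrable lborel f"
proof -
  have "(\<lambda>x. indicator S x *\<^sub>R f x) = f"
    using assms(3) by (auto simp: indicator_def fun_eq_iff)
  then show ?thesis
    using borel_integrable_compact[OF assms(2) continuous_on_subset[OF assms(1)]] by simp
qed

lemma bounded_continuous_compact_support:
  fixes f :: "'a::euclidean_space \<Rightarrow> real"
  assumes "continuous_on UNIV f" "compact S" "\<And>x. x \<notin> S \<Longrightarrow> f x = 0"
  obtains B where "B > 0" "\<And>x. \<bar>f x\<bar> \<le> B"
proof -
  have "bounded (f ` S)"
    by (intro compact_imp_bounded compact_continuous_image continuous_on_subset[OF assms(1)] assms(2))
      simp
  then obtain B where "B > 0" "\<And>x. x \<in> S \<Longrightarrow> \<bar>f x\<bar> \<le> B"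
    by (auto simp: bounded_pos)
  then have "\<bar>f x\<bar> \<le> B" for x
    using assms(3)[of x] by (cases "x \<in> S") auto
  with \<open>B > 0\<close> show thesis by (rule that)
qed

lemma L2_continuous_compact_support:
  fixes f :: "'a::euclidean_space \<Rightarrow> real"
  assumes "\<Omega> \<in> sets lebesgue"
    and f: "continuous_on UNIV f" "compact S" "\<And>x. x \<notin> S \<Longrightarrow> f x = 0"
  shows "f \<in> L2 \<Omega>"
proof -
  have meas: "f \<in> borel_measurable borel"
    using f(1) by (rule borel_measurable_continuous_onI)
  have "f \<in> borel_measurable lebesgue"
    using meas by (intro measurable_completion) simp
  then have "f \<in> borel_measurable (lebesgue_on \<Omega>)"
    by (rule measurable_restrict_space1)
  moreover have "integrable (lebesgue_on \<Omega>) (\<lambda>x. f x \<bullet> f x)"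
  proof -
    have "integrable lborel (\<lambda>x. f x \<bullet> f x)"
      by (rule integrable_continuous_compact_support[of _ S])
        (use f in \<open>auto intro!: continuous_intros\<close>)
    then have "integrable lebesgue (\<lambda>x. f x \<bullet> f x)"
      using meas by (subst integrable_completion) auto
    then show ?thesis
      using assms(1) integrable_mult_indicator[of \<Omega> lebesgue "\<lambda>x. f x \<bullet> f x"]
      by (subst integrable_restrict_space) auto
  qed
  ultimately show ?thesis by (simp add: L2_iff)
qed

lemma test_functionsE:
  assumes "\<phi> \<in> test_functions \<Omega>"
  obtains S where "compact S" "S \<subseteq> \<Omega>" "\<And>x. x \<notin> S \<Longrightarrow> \<phi> x = 0"
    "\<And>i x. x \<notin> S \<Longrightarrow> partial_deriv i \<phi> x = 0"
proof -
  obtain S where S: "compact S" "S \<subseteq> \<Omega>" "\<And>x. x \<notin> S \<Longrightarrow> \<phi> x = 0"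
    using assms by (auto simp: test_functions_def)
  have "partial_deriv i \<phi> x = 0" if "x \<notin> S" for i x
  proof -
    have "((\<lambda>x. 0) has_derivative (\<lambda>h. 0)) (at x)" by simp
    then have "(\<phi> has_derivative (\<lambda>h. 0)) (at x)"
      by (rule has_derivative_transform_within_open[where s = "- S"])
        (use S that in \<open>auto intro: compact_imp_closed\<close>)
    then show ?thesis by (rule partial_deriv_eq)
  qed
  with S that show thesis by blast
qed

lemma test_function_has_derivative:
  assumes "\<phi> \<in> test_functions \<Omega>"
  shows "(\<phi> has_derivative frechet_derivative \<phi> (at x)) (at x)"
proof -
  have "C_times 1 \<phi>" using assms by (simp add: test_functions_def)
  then show ?thesis
    by (simp add: differentiable_on_def frechet_derivative_works)
qed

lemma test_function_continuous: "\<phi> \<in> test_functions \<Omega> \<Longrightarrow> continuous_on UNIV \<phi>"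
  unfolding test_functions_def by (metis (no_types, lifting) C_times.simps(1) mem_Collect_eq)

lemma test_function_partial_continuous:
  assumes "\<phi> \<in> test_functions \<Omega>" "i \<in> Basis"
  shows "continuous_on UNIV (partial_deriv i \<phi>)"
proof -
  have "C_times (Suc 0) \<phi>" using assms(1) by (simp add: test_functions_def)
  then show ?thesis using assms(2) by simp
qed

lemma test_function_L2:
  assumes "\<Omega> \<in> sets lebesgue" "\<phi> \<in> test_functions \<Omega>"
  shows "\<phi> \<in> L2 \<Omega>"
  using test_functionsE[OF assms(2)] L2_continuous_compact_support[OF assms(1)]
    test_function_continuous[OF assms(2)] by metis

lemma test_function_partial_L2:
  assumes "\<Omega> \<in> sets lebesgue" "\<phi> \<in> test_functions \<Omega>" "i \<in> Basis"
  shows "partial_deriv i \<phi> \<in> L2 \<Omega>"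
  using test_functionsE[OF assms(2)] L2_continuous_compact_support[OF assms(1)]
    test_function_partial_continuous[OF assms(2,3)] by metis

lemma C_times_add: "C_times k f \<Longrightarrow> C_times k g \<Longrightarrow> C_times k (\<lambda>x. f x + g x)"
proof (induction k arbitrary: f g)
  case 0
  then show ?case by (auto intro: continuous_intros)
next
  case (Suc k)
  have "partial_deriv i (\<lambda>x. f x + g x) = (\<lambda>x. partial_deriv i f x + partial_deriv i g x)" for i
  proof
    fix x
    have "(f has_derivative frechet_derivative f (at x)) (at x)"
      "(g has_derivative frechet_derivative g (at x)) (at x)"
      using Suc.prems by (auto simp: differentiable_on_def frechet_derivative_works)
    from has_derivative_add[OF this]
    show "partial_deriv i (\<lambda>x. f x + g x) x = partial_deriv i f x + partial_deriv i g x"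
      unfolding partial_deriv_eq[OF has_derivative_add[OF \<open>(f has_derivative _) _\<close> \<open>(g has_derivative _) _\<close>]]
      by (simp add: partial_deriv_def)
  qed
  with Suc show ?case by auto
qed

lemma C_times_scale: "C_times k f \<Longrightarrow> C_times k (\<lambda>x. c * f x)"
proof (induction k arbitrary: f)
  case 0
  then show ?case by (auto intro: continuous_intros)
next
  case (Suc k)
  have "partial_deriv i (\<lambda>x. c * f x) = (\<lambda>x. c * partial_deriv i f x)" for i
  proof
    fix x
    have "(f has_derivative frechet_derivative f (at x)) (at x)"
      using Suc.prems by (auto simp: differentiable_on_def frechet_derivative_works)
    from partial_deriv_eq[OF has_derivative_mult_right[OF this]]
    show "partial_deriv i (\<lambda>x. c * f x) x = c * partial_deriv i f x"
      by (simp add: partial_deriv_def)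
  qed
  with Suc show ?case by auto
qed

lemma test_functions_add:
  assumes "\<phi> \<in> test_functions \<Omega>" "\<psi> \<in> test_functions \<Omega>"
  shows "\<phi> + \<psi> \<in> test_functions \<Omega>"
proof -
  obtain S T where "compact S" "S \<subseteq> \<Omega>" "\<forall>x. x \<notin> S \<longrightarrow> \<phi> x = 0"
    "compact T" "T \<subseteq> \<Omega>" "\<forall>x. x \<notin> T \<longrightarrow> \<psi> x = 0"
    using assms by (auto simp: test_functions_def)
  then have "compact (S \<union> T)" "S \<union> T \<subseteq> \<Omega>" "\<forall>x. x \<notin> S \<union> T \<longrightarrow> \<phi> x + \<psi> x = 0"
    by auto
  moreover have "C_times k (\<lambda>x. \<phi> x + \<psi> x)" for k
    using assms by (intro C_times_add) (simp_all add: test_functions_def)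
  ultimately show ?thesis
    unfolding test_functions_def plus_fun_def by blast
qed

lemma test_functions_scaleR:
  assumes "\<phi> \<in> test_functions \<Omega>"
  shows "c *\<^sub>R \<phi> \<in> test_functions \<Omega>"
proof -
  obtain S where "compact S" "S \<subseteq> \<Omega>" "\<forall>x. x \<notin> S \<longrightarrow> \<phi> x = 0"
    using assms by (auto simp: test_functions_def)
  then have "compact S" "S \<subseteq> \<Omega>" "\<forall>x. x \<notin> S \<longrightarrow> c * \<phi> x = 0"
    by auto
  moreover have "C_times k (\<lambda>x. c * \<phi> x)" for k
    using assms by (intro C_times_scale) (simp add: test_functions_def)
  ultimately show ?thesis
    unfolding test_functions_def scaleR_fun_def real_scaleR_def by blast
qed

text \<open>The difference quotients of \<open>h\<close> have integral zero by translation invariance, and they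
  converge to the partial derivative boundedly and with a common compact support.\<close>

lemma integral_partial_deriv_eq_0:
  fixes h :: "'a::euclidean_space \<Rightarrow> real"
  assumes i: "i \<in> Basis"
    and der: "\<And>x. (h has_derivative D x) (at x)"
    and cont: "continuous_on UNIV (\<lambda>x. D x i)"
    and S: "compact S" "\<And>x. x \<notin> S \<Longrightarrow> h x = 0" "\<And>x. x \<notin> S \<Longrightarrow> D x i = 0"
  shows "(LINT x|lborel. D x i) = 0"
proof -
  have h_cont: "continuous_on UNIV h"
    using der has_derivative_continuous_on[of UNIV h D] by (simp add: has_derivative_at_withinI)
  have h_int: "integrable lborel h"
    using h_cont S(1,2) by (rule integrable_continuous_compact_support)
  obtain B where B: "B > 0" "\<And>x. \<bar>D x i\<bar> \<le> B"
    using bounded_continuous_compact_support[OF cont S(1,3)] by blast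
  obtain R where R: "\<And>x. x \<in> S \<Longrightarrow> norm x \<le> R"
    using compact_imp_bounded[OF S(1)] by (auto simp: bounded_iff)
  define t where "t n = inverse (real (Suc n))" for n
  have t: "t n > 0" "t n \<le> 1" for n by (auto simp: t_def inverse_le_1_iff)
  have t_lim: "t \<longlonglongrightarrow> 0" unfolding t_def by (rule LIMSEQ_inverse_real_of_nat)
  define q where "q n x = (h (t n *\<^sub>R i + x) - h x) / t n" for n x
  have line: "((\<lambda>s. h (s *\<^sub>R i + x)) has_real_derivative D (s *\<^sub>R i + x) i) (at s)" for s x
  proof -
    have "((\<lambda>s. s *\<^sub>R i + x) has_derivative (\<lambda>k. k *\<^sub>R i)) (at s)"
      by (auto intro!: derivative_eq_intros)
    from has_derivative_compose[OF this der]
    have "((\<lambda>s. h (s *\<^sub>R i + x)) has_derivative (\<lambda>k. D (s *\<^sub>R i + x) (k *\<^sub>R i))) (at s)" .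
    moreover have "D (s *\<^sub>R i + x) (k *\<^sub>R i) = D (s *\<^sub>R i + x) i * k" for k
      using linear_scale[OF has_derivative_linear[OF der]] by (simp add: mult.commute)
    ultimately show ?thesis by (simp add: has_field_derivative_def)
  qed
  have q_lim: "(\<lambda>n. q n x) \<longlonglongrightarrow> D x i" for x
  proof -
    have "((\<lambda>k. (h ((0 + k) *\<^sub>R i + x) - h (0 *\<^sub>R i + x)) / k) \<longlongrightarrow> D (0 *\<^sub>R i + x) i) (at 0)"
      using line[of x 0] by (simp add: DERIV_def)
    moreover have "filterlim t (at 0) sequentially"
      using t_lim t(1) by (auto simp: filterlim_at less_imp_neq[symmetric])
    ultimately have "(\<lambda>n. (h ((0 + t n) *\<^sub>R i + x) - h (0 *\<^sub>R i + x)) / t n) \<longlonglongrightarrow> D (0 *\<^sub>R i + x) i"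
      by (rule filterlim_compose)
    then show ?thesis by (simp add: q_def)
  qed
  have q_bound: "\<bar>q n x\<bar> \<le> B * indicator (cball 0 (R + 1)) x" for n x
  proof (cases "norm x \<le> R + 1")
    case True
    obtain s where "0 < s" "s < t n" "h (t n *\<^sub>R i + x) - h (0 *\<^sub>R i + x) = (t n - 0) * D (s *\<^sub>R i + x) i"
      using MVT2[of 0 "t n" "\<lambda>s. h (s *\<^sub>R i + x)", OF t(1) line] by blast
    then have "q n x = D (s *\<^sub>R i + x) i" using t(1)[of n] by (simp add: q_def)
    then show ?thesis using B(2) True by simp
  next
    case False
    then have "x \<notin> S" using R by fastforce
    moreover have "norm x \<le> norm (t n *\<^sub>R i + x) + norm (t n *\<^sub>R i)"
      by (metis add_diff_cancel_left' norm_triangle_ineq4 add.commute)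
    then have "t n *\<^sub>R i + x \<notin> S"
      using False R[of "t n *\<^sub>R i + x"] t[of n] i by auto
    ultimately show ?thesis using S(2) B(1) by (simp add: q_def)
  qed
  have shift_int: "integrable lborel (\<lambda>x. h (c + x))" "(LINT x|lborel. h (c + x)) = (LINT x|lborel. h x)" for c
  proof -
    have meas: "h \<in> borel_measurable borel" using h_cont by (rule borel_measurable_continuous_onI)
    show "integrable lborel (\<lambda>x. h (c + x))"
      using h_int by (subst (asm) lborel_distr_plus[of c, symmetric])
        (auto simp: meas integrable_distr_eq)
    show "(LINT x|lborel. h (c + x)) = (LINT x|lborel. h x)"
      by (subst (2) lborel_distr_plus[of c, symmetric]) (auto simp: meas integral_distr)
  qed
  have q_int: "(LINT x|lborel. q n x) = 0" for n
    unfolding q_def using shift_int[of "t n *\<^sub>R i"] h_int by simp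
  have "(\<lambda>n. LINT x|lborel. q n x) \<longlonglongrightarrow> (LINT x|lborel. D x i)"
  proof (rule integral_dominated_convergence)
    show "(\<lambda>x. D x i) \<in> borel_measurable lborel"
      using cont by (simp add: borel_measurable_continuous_onI)
    show "q n \<in> borel_measurable lborel" for n
      unfolding q_def[abs_def] using shift_int[of "t n *\<^sub>R i"] h_int
      by (intro borel_measurable_integrable integrable_diff integrable_divide) auto
    have "emeasure lborel (cball (0::'a) (R + 1)) < \<infinity>"
      by (rule emeasure_bounded_finite) simp
    then show "integrable lborel (\<lambda>x::'a. B * indicator (cball 0 (R + 1)) x)"
      by (intro integrable_mult_right integrable_real_indicator) auto
    show "AE x in lborel. (\<lambda>n. q n x) \<longlonglongrightarrow> D x i"
      using q_lim by simp
    show "AE x in lborel. norm (q n x) \<le> B * indicator (cball 0 (R + 1)) x" for n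
      using q_bound by simp
  qed
  then show ?thesis
    unfolding q_int by (simp add: LIMSEQ_const_iff)
qed

lemma L2_inner_eq_lborel:
  fixes f g :: "'a::euclidean_space \<Rightarrow> real"
  assumes "\<Omega> \<in> sets lebesgue" "continuous_on UNIV f" "continuous_on UNIV g"
    and "\<And>x. x \<notin> \<Omega> \<Longrightarrow> f x * g x = 0"
  shows "L2_inner \<Omega> f g = (LINT x|lborel. f x * g x)"
proof -
  have "(\<lambda>x. indicator \<Omega> x *\<^sub>R (f x \<bullet> g x)) = (\<lambda>x. f x * g x)"
    using assms(4) by (auto simp: indicator_def fun_eq_iff)
  moreover have "(\<lambda>x. f x * g x) \<in> borel_measurable lborel"
    using assms(2,3) by (simp add: borel_measurable_continuous_onI continuous_on_mult)
  ultimately show ?thesis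
    unfolding L2_inner_def using assms(1)
    by (subst integral_restrict_space) (auto simp: integral_completion)
qed

lemma test_function_integration_by_parts:
  assumes \<Omega>: "\<Omega> \<in> sets lebesgue"
    and \<phi>: "\<phi> \<in> test_functions \<Omega>" and \<psi>: "\<psi> \<in> test_functions \<Omega>" and i: "i \<in> Basis"
  shows "L2_inner \<Omega> \<phi> (partial_deriv i \<psi>) = - L2_inner \<Omega> (partial_deriv i \<phi>) \<psi>"
proof -
  obtain S where S: "compact S" "S \<subseteq> \<Omega>" "\<And>x. x \<notin> S \<Longrightarrow> \<phi> x = 0"
    "\<And>i x. x \<notin> S \<Longrightarrow> partial_deriv i \<phi> x = 0"
    using test_functionsE[OF \<phi>] by blast
  note cont = test_function_continuous[OF \<phi>] test_function_continuous[OF \<psi>]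
    test_function_partial_continuous[OF \<phi> i] test_function_partial_continuous[OF \<psi> i]
  let ?D = "\<lambda>x h. \<phi> x * frechet_derivative \<psi> (at x) h + frechet_derivative \<phi> (at x) h * \<psi> x"
  have off: "\<phi> x = 0" "partial_deriv i \<phi> x = 0" if "x \<notin> \<Omega>" for x
    using S(2) S(3)[of x] S(4)[of x i] that by auto
  have "(LINT x|lborel. ?D x i) = 0"
  proof (rule integral_partial_deriv_eq_0[OF i])
    show "((\<lambda>x. \<phi> x * \<psi> x) has_derivative ?D x) (at x)" for x
      by (intro has_derivative_mult test_function_has_derivative[OF \<phi>] test_function_has_derivative[OF \<psi>])
    show "continuous_on UNIV (\<lambda>x. ?D x i)"
      using cont by (auto simp: partial_deriv_def[abs_def] intro!: continuous_intros)
    show "compact S" by (rule S)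
    show "\<phi> x * \<psi> x = 0" "?D x i = 0" if "x \<notin> S" for x
      using S(3)[OF that] S(4)[OF that, of i] by (auto simp: partial_deriv_def)
  qed
  then have "(LINT x|lborel. \<phi> x * partial_deriv i \<psi> x + partial_deriv i \<phi> x * \<psi> x) = 0"
    by (simp add: partial_deriv_def)
  moreover have "integrable lborel (\<lambda>x. \<phi> x * partial_deriv i \<psi> x)"
    "integrable lborel (\<lambda>x. partial_deriv i \<phi> x * \<psi> x)"
    using cont S by (auto intro!: integrable_continuous_compact_support[OF _ S(1)] continuous_intros)
  moreover have "L2_inner \<Omega> \<phi> (partial_deriv i \<psi>) = (LINT x|lborel. \<phi> x * partial_deriv i \<psi> x)"
    "L2_inner \<Omega> (partial_deriv i \<phi>) \<psi> = (LINT x|lborel. partial_deriv i \<phi> x * \<psi> x)"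
    using cont off by (simp_all add: L2_inner_eq_lborel[OF \<Omega>])
  ultimately show ?thesis by simp
qed


section \<open>The fundamental lemma of the calculus of variations\<close>

text \<open>The sets over which \<open>h\<close> integrates to zero form a Dynkin system that contains the boxes, hence
  all Borel sets, in particular \<open>{h > 0}\<close> and \<open>{h < 0}\<close>.\<close>

lemma AE_zero_of_box_integrals:
  fixes h :: "'a::euclidean_space \<Rightarrow> real"
  assumes h: "integrable lborel h"
    and zero: "\<And>a b. (LINT x:box a b|lborel. h x) = 0"
  shows "AE x in lborel. h x = 0"
proof -
  let ?G = "range (\<lambda>(a, b). box a b :: 'a set)"
  have int: "set_integrable lborel A h" if "A \<in> sets borel" for A
    unfolding set_integrable_def using h that by (intro integrable_mult_indicator) auto
  have h_meas [measurable]: "h \<in> borel_measurable borel"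
    using borel_measurable_integrable[OF h] by simp
  have UNIV_zero: "(LINT x|lborel. h x) = 0"
  proof -
    define K :: "nat \<Rightarrow> 'a set" where "K n = box (- real n *\<^sub>R One) (real n *\<^sub>R One)" for n
    have "(\<lambda>n. LINT x|lborel. indicator (K n) x *\<^sub>R h x) \<longlonglongrightarrow> (LINT x|lborel. h x)"
    proof (rule integral_dominated_convergence)
      show "integrable lborel (\<lambda>x. \<bar>h x\<bar>)" using h by simp
      show "(\<lambda>x. indicator (K n) x *\<^sub>R h x) \<in> borel_measurable lborel" for n
        unfolding K_def by measurable
      show "AE x in lborel. norm (indicator (K n) x *\<^sub>R h x) \<le> \<bar>h x\<bar>" for n
        by (auto simp: indicator_def)
      have "(\<lambda>n. indicator (K n) x *\<^sub>R h x) \<longlonglongrightarrow> h x" for x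
      proof -
        obtain N where N: "norm x < real N" using reals_Archimedean2 by blast
        have "indicator (K n) x *\<^sub>R h x = h x" if "n \<ge> N" for n
        proof -
          have "\<bar>x \<bullet> i\<bar> < real n" if "i \<in> Basis" for i
            using Basis_le_norm[OF that, of x] N \<open>n \<ge> N\<close> by linarith
          then have "x \<in> K n"
            unfolding K_def mem_box by (auto simp: abs_less_iff inner_sum_left_Basis) (smt (verit))
          then show ?thesis by simp
        qed
        then show ?thesis by (intro tendsto_eventually eventually_sequentiallyI)
      qed
      then show "AE x in lborel. (\<lambda>n. indicator (K n) x *\<^sub>R h x) \<longlonglongrightarrow> h x" by simp
    qed simp
    moreover have "(LINT x|lborel. indicator (K n) x *\<^sub>R h x) = 0" for n
      using zero unfolding K_def set_lebesgue_integral_def by blast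
    ultimately show ?thesis by (simp add: LIMSEQ_const_iff)
  qed
  have sets_eq: "sets (borel :: 'a measure) = sigma_sets UNIV ?G"
    unfolding borel_eq_box by (rule sets_measure_of) simp
  have all: "(LINT x:A|lborel. h x) = 0" if "A \<in> sigma_sets UNIV ?G" for A
  proof (rule sigma_sets_induct_disjoint[OF _ _ that])
    show "Int_stable ?G"
      unfolding Int_stable_def by (force simp: box_Int_box)
    show "?G \<subseteq> Pow UNIV" by simp
    show "(LINT x:A|lborel. h x) = 0" if "A \<in> ?G" for A using that zero by auto
    show "(LINT x:{}|lborel. h x) = 0" by (simp add: set_lebesgue_integral_def)
  next
    fix A assume A: "A \<in> sigma_sets UNIV ?G" "(LINT x:A|lborel. h x) = 0"
    have "A \<in> sets borel" using A sets_eq by blast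
    then have "(LINT x:A \<union> (UNIV - A)|lborel. h x) = (LINT x:A|lborel. h x) + (LINT x:UNIV - A|lborel. h x)"
      by (intro set_integral_Un int) auto
    moreover have "(LINT x:A \<union> (UNIV - A)|lborel. h x) = 0"
      using UNIV_zero by (simp add: set_lebesgue_integral_def)
    ultimately show "(LINT x:UNIV - A|lborel. h x) = 0" using A(2) by simp
  next
    fix A :: "nat \<Rightarrow> 'a set"
    assume A: "disjoint_family A" "range A \<subseteq> sigma_sets UNIV ?G" "\<And>i. (LINT x:A i|lborel. h x) = 0"
    have meas: "A i \<in> sets borel" for i using A(2) sets_eq by blast
    have "(LINT x:(\<Union>i. A i)|lborel. h x) = (\<Sum>i. (LINT x:(A i)|lborel. h x))"
      using A(1) meas by (intro lebesgue_integral_countable_add int) (auto simp: disjoint_family_on_def)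
    then show "(LINT x:(\<Union>i. A i)|lborel. h x) = 0" using A(3) by simp
  qed
  have "{x. h x > 0} \<in> sets borel" "{x. h x < 0} \<in> sets borel" by measurable
  note P = all[OF this(1)[unfolded sets_eq]] and N = all[OF this(2)[unfolded sets_eq]]
    and int[OF this(1)] and int[OF this(2)]
  have "AE x in lborel. indicator {x. h x > 0} x *\<^sub>R h x = 0"
    using P \<open>set_integrable lborel {x. h x > 0} h\<close>
    unfolding set_lebesgue_integral_def set_integrable_def
    by (subst (asm) integral_nonneg_eq_0_iff_AE) (auto simp: indicator_def)
  moreover have "AE x in lborel. - (indicator {x. h x < 0} x *\<^sub>R h x) = 0"
    using N \<open>set_integrable lborel {x. h x < 0} h\<close>
      integral_nonneg_eq_0_iff_AE[of lborel "\<lambda>x. - (indicator {x. h x < 0} x *\<^sub>R h x)"]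
    unfolding set_lebesgue_integral_def set_integrable_def
    by (auto simp: indicator_def)
  ultimately show ?thesis
    by eventually_elim (auto simp: indicator_def split: if_splits)
qed

text \<open>On a closed box inside \<open>\<Omega>\<close>, smooth bumps converge boundedly to the indicators of smaller
  boxes; countably many closed boxes cover \<open>\<Omega>\<close>.\<close>

theorem test_functions_fundamental_lemma:
  fixes g :: "'a::euclidean_space \<Rightarrow> real"
  assumes \<Omega>: "open \<Omega>" and g: "g \<in> L2 \<Omega>"
    and orth: "\<And>\<phi>. \<phi> \<in> test_functions \<Omega> \<Longrightarrow> L2_inner \<Omega> g \<phi> = 0"
  shows "AE x in lebesgue_on \<Omega>. g x = 0"
proof -
  have \<Omega>_leb: "\<Omega> \<in> sets lebesgue" using \<Omega> by (simp add: sets_completionI_sets)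
  have box_zero: "AE x in lebesgue. x \<in> cbox c d \<longrightarrow> g x = 0" if Q: "cbox c d \<subseteq> \<Omega>" for c d
  proof -
    have Q': "box c d \<subseteq> \<Omega>" using Q box_subset_cbox[of c d] by blast
    have ind_int: "integrable lebesgue (indicator (box c d) :: 'a \<Rightarrow> real)"
      using lmeasurable_box[of c d] by (intro integrable_real_indicator) (auto simp: fmeasurable_def)
    have "(indicator (box c d) :: 'a \<Rightarrow> real) \<in> borel_measurable (lebesgue_on \<Omega>)"
      by (rule measurable_restrict_space1, rule borel_measurable_integrable[OF ind_int])
    moreover have "(\<lambda>x. indicator \<Omega> x *\<^sub>R ((indicator (box c d) x :: real) \<bullet> indicator (box c d) x))
        = (indicator (box c d) :: 'a \<Rightarrow> real)"
      using Q' by (auto simp: indicator_def fun_eq_iff)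
    with ind_int have "integrable (lebesgue_on \<Omega>) (\<lambda>x. indicator (box c d) x \<bullet> (indicator (box c d) x :: real))"
      using \<Omega>_leb by (simp add: integrable_restrict_space)
    ultimately have "(indicator (box c d) :: 'a \<Rightarrow> real) \<in> L2 \<Omega>"
      unfolding L2_iff by (rule conjI)
    then have "integrable lebesgue (\<lambda>x. indicator \<Omega> x *\<^sub>R (g x \<bullet> indicator (box c d) x))"
      using L2_integrable_inner[OF g] \<Omega>_leb by (simp add: integrable_restrict_space)
    moreover have "(\<lambda>x. indicator \<Omega> x *\<^sub>R (g x \<bullet> indicator (box c d) x)) = (\<lambda>x. indicator (box c d) x * g x)"
      using Q' by (auto simp: indicator_def fun_eq_iff)
    ultimately have int: "integrable lebesgue (\<lambda>x. indicator (box c d) x * g x)" by simp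
    obtain h where h: "h \<in> borel_measurable lborel" "AE x in lborel. indicator (box c d) x * g x = h x"
      using completion_ex_borel_measurable_real[OF borel_measurable_integrable[OF int]] by blast
    have h_leb: "AE x in lebesgue. indicator (box c d) x * g x = h x"
      using h(2) by (rule AE_completion)
    have h_meas: "h \<in> borel_measurable lebesgue" using h(1) by (rule measurable_completion)
    have "integrable lebesgue h"
      using integrable_cong_AE_imp[OF int h_meas] h_leb by (simp add: eq_commute)
    then have h_int: "integrable lborel h"
      using integrable_completion[OF h(1)] by blast
    have "(LINT x:box a b|lborel. h x) = 0" for a b
    proof (cases "box a b \<inter> box c d = {}")
      case True
      have "AE x in lebesgue. indicator (box a b) x *\<^sub>R h x = 0"
        using h_leb
      proof eventually_elim
        case (elim x)
        show ?case
        proof (cases "x \<in> box a b")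
          case x: True
          then have "x \<notin> box c d" using True by blast
          then show ?thesis using elim x by simp
        qed simp
      qed
      then have "AE x in lborel. indicator (box a b) x *\<^sub>R h x = 0"
        by (simp only: AE_completion_iff)
      then show ?thesis
        unfolding set_lebesgue_integral_def by (rule integral_eq_zero_AE)
    next
      case False
      obtain a' b' where ab: "box a b \<inter> box c d = box a' b'"
        using box_Int_box[of a b c d] by blast
      have "cbox a' b' = closure (box a' b')"
        using False ab by (simp add: closure_box)
      also have "\<dots> \<subseteq> cbox c d"
        using ab box_subset_cbox[of c d] by (intro closure_minimal) auto
      finally have sub: "cbox a' b' \<subseteq> \<Omega>" using Q by blast
      have zero_off: "box_bump a' b' (real (Suc n)) x = 0" if "x \<notin> box a' b'" for n x
        by (rule box_bump_eq_0) (use that in auto)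
      let ?f = "\<lambda>n x. indicator \<Omega> x *\<^sub>R (g x \<bullet> box_bump a' b' (real (Suc n)) x)"
      have "?f n x = indicator (box c d) x * g x * box_bump a' b' (real (Suc n)) x" for n x
        using ab Q' zero_off[of x n] by (cases "x \<in> box a' b'") (auto simp: indicator_def)
      then have f_eq: "?f n = (\<lambda>x. indicator (box c d) x * g x * box_bump a' b' (real (Suc n)) x)" for n
        by blast
      have tf: "box_bump a' b' (real (Suc n)) \<in> test_functions \<Omega>" for n
        by (rule box_bump_test_function) (use sub in auto)
      have bump_meas: "box_bump a' b' (real (Suc n)) \<in> borel_measurable lebesgue" for n
        using test_function_continuous[OF tf] 
        by (intro measurable_completion) (simp add: borel_measurable_continuous_onI)
      have "(\<lambda>n. LINT x|lebesgue. ?f n x) \<longlonglongrightarrow> (LINT x|lebesgue. indicator (box a b) x *\<^sub>R h x)"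
        unfolding f_eq
      proof (rule integral_dominated_convergence)
        show "integrable lebesgue (\<lambda>x. \<bar>indicator (box c d) x * g x\<bar>)" using int by (rule integrable_abs)
        have "(indicator (box a b) :: 'a \<Rightarrow> real) \<in> borel_measurable lebesgue"
          by (intro measurable_completion) simp
        then show "(\<lambda>x. indicator (box a b) x *\<^sub>R h x) \<in> borel_measurable lebesgue"
          using h_meas by (rule borel_measurable_scaleR)
        show "(\<lambda>x. indicator (box c d) x * g x * box_bump a' b' (real (Suc n)) x)
            \<in> borel_measurable lebesgue" for n
          using borel_measurable_integrable[OF int] bump_meas by (rule borel_measurable_times)
        show "AE x in lebesgue. (\<lambda>n. indicator (box c d) x * g x * box_bump a' b' (real (Suc n)) x)
            \<longlonglongrightarrow> indicator (box a b) x *\<^sub>R h x"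
          using h_leb
        proof eventually_elim
          case (elim x)
          have "(\<lambda>n. indicator (box c d) x * g x * box_bump a' b' (real (Suc n)) x)
              \<longlonglongrightarrow> indicator (box c d) x * g x * indicator (box a' b') x"
            by (intro tendsto_mult tendsto_const box_bump_tendsto)
          also have "indicator (box c d) x * g x * indicator (box a' b') x = indicator (box a b) x *\<^sub>R h x"
            unfolding elim[symmetric] ab[symmetric] by (simp add: indicator_def)
          finally show ?case .
        qed
        show "AE x in lebesgue. norm (indicator (box c d) x * g x * box_bump a' b' (real (Suc n)) x)
            \<le> \<bar>indicator (box c d) x * g x\<bar>" for n
        proof (rule AE_I2)
          fix x
          have "\<bar>indicator (box c d) x * g x\<bar> * \<bar>box_bump a' b' (real (Suc n)) x\<bar>
              \<le> \<bar>indicator (box c d) x * g x\<bar> * 1"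
            by (intro mult_left_mono box_bump_le_1) simp
          then show "norm (indicator (box c d) x * g x * box_bump a' b' (real (Suc n)) x)
              \<le> \<bar>indicator (box c d) x * g x\<bar>"
            by (simp only: real_norm_def abs_mult mult_1_right)
        qed
      qed
      moreover have "(LINT x|lebesgue. ?f n x) = L2_inner \<Omega> g (box_bump a' b' (real (Suc n)))" for n
        unfolding L2_inner_def
        by (rule integral_restrict_space[symmetric]) (use \<Omega>_leb in simp)
      ultimately have "(\<lambda>n. 0) \<longlonglongrightarrow> (LINT x|lebesgue. indicator (box a b) x *\<^sub>R h x)"
        by (simp only: orth[OF tf])
      then have "(LINT x|lebesgue. indicator (box a b) x *\<^sub>R h x) = 0"
        using LIMSEQ_unique tendsto_const by blast
      then show ?thesis
        unfolding set_lebesgue_integral_def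
        by (subst (asm) integral_completion) (use h(1) in measurable)
    qed
    then have "AE x in lborel. h x = 0" by (rule AE_zero_of_box_integrals[OF h_int])
    then have "AE x in lebesgue. h x = 0" by (rule AE_completion)
    moreover have "AE x in lebesgue. x \<notin> cbox c d - box c d"
      using negligible_frontier_interval[of c d] by (intro AE_not_in) (simp add: negligible_iff_null_sets)
    ultimately show ?thesis
      using h_leb
    proof eventually_elim
      case (elim x)
      then show ?case by (cases "x \<in> box c d") simp_all
    qed
  qed
  define l r where "l = (\<lambda>f::'a \<Rightarrow> real \<times> real. \<Sum>i\<in>Basis. fst (f i) *\<^sub>R i)"
    and "r = (\<lambda>f::'a \<Rightarrow> real \<times> real. \<Sum>i\<in>Basis. snd (f i) *\<^sub>R i)"
  define I where "I = {f\<in>Basis \<rightarrow>\<^sub>E \<rat> \<times> \<rat>. cbox (l f) (r f) \<subseteq> \<Omega>}"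
  have cover: "\<Omega> = (\<Union>f\<in>I. cbox (l f) (r f))"
    unfolding I_def l_def r_def by (rule open_UNION_cbox[OF \<Omega>])
  have "countable I"
    unfolding I_def by (rule countable_subset[of _ "Basis \<rightarrow>\<^sub>E \<rat> \<times> \<rat>"])
      (auto intro!: countable_PiE countable_SIGMA countable_rat)
  then have "AE x in lebesgue. \<forall>f\<in>I. x \<in> cbox (l f) (r f) \<longrightarrow> g x = 0"
    using box_zero by (subst AE_ball_countable) (auto simp: I_def)
  then have "AE x in lebesgue. x \<in> \<Omega> \<longrightarrow> g x = 0"
    by eventually_elim (use cover in blast)
  then show ?thesis
    using \<Omega>_leb by (subst AE_restrict_space_iff) auto
qed


section \<open>Sobolev spaces\<close>

text \<open>Stated for measurable maps of linear growth, since it is also applied to negative parts.\<close>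

lemma L2_bounded_image:
  assumes f: "f \<in> L2 \<Omega>" and meas: "(\<lambda>x. T (f x)) \<in> borel_measurable (lebesgue_on \<Omega>)"
    and bound: "\<And>y. norm (T y) \<le> C * norm y"
  shows "(\<lambda>x. T (f x)) \<in> L2 \<Omega>"
proof -
  have "integrable (lebesgue_on \<Omega>) (\<lambda>x. C\<^sup>2 * (norm (f x))\<^sup>2)"
    using f by (simp add: L2_def)
  moreover have "AE x in lebesgue_on \<Omega>. norm ((norm (T (f x)))\<^sup>2) \<le> norm (C\<^sup>2 * (norm (f x))\<^sup>2)"
    using power_mono[OF bound norm_ge_zero, of _ 2] by (auto simp: power_mult_distrib)
  moreover have "(\<lambda>x. (norm (T (f x)))\<^sup>2) \<in> borel_measurable (lebesgue_on \<Omega>)"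
    using meas by measurable
  ultimately have "integrable (lebesgue_on \<Omega>) (\<lambda>x. (norm (T (f x)))\<^sup>2)"
    using Bochner_Integration.integrable_bound by blast
  with meas show ?thesis by (simp add: L2_def)
qed

lemma L2_bounded_linear_image:
  assumes "bounded_linear T" "f \<in> L2 \<Omega>"
  shows "(\<lambda>x. T (f x)) \<in> L2 \<Omega>"
proof -
  interpret T: bounded_linear T by fact
  obtain C where "\<And>y. norm (T y) \<le> norm y * C" using T.bounded by blast
  moreover have "T \<in> borel_measurable borel"
    using T.continuous_on[OF continuous_on_id] by (simp add: borel_measurable_continuous_onI)
  then have "(\<lambda>x. T (f x)) \<in> borel_measurable (lebesgue_on \<Omega>)"
    using measurable_compose[OF L2_measurable[OF assms(2)]] by blast
  ultimately show ?thesis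
    by (intro L2_bounded_image[OF assms(2), where C = C]) (auto simp: mult.commute)
qed

lemma L2_component: "G \<in> L2 \<Omega> \<Longrightarrow> (\<lambda>x. G x \<bullet> i) \<in> L2 \<Omega>"
  by (rule L2_bounded_linear_image[OF bounded_linear_inner_left])

lemma L2_fst: "F \<in> L2 \<Omega> \<Longrightarrow> (\<lambda>x. fst (F x)) \<in> L2 \<Omega>"
  by (rule L2_bounded_linear_image[OF bounded_linear_fst])

lemma L2_snd: "F \<in> L2 \<Omega> \<Longrightarrow> (\<lambda>x. snd (F x)) \<in> L2 \<Omega>"
  by (rule L2_bounded_linear_image[OF bounded_linear_snd])

lemma L2_Pair:
  assumes "v \<in> L2 \<Omega>" "G \<in> L2 \<Omega>"
  shows "(\<lambda>x. (v x, G x)) \<in> L2 \<Omega>"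
proof -
  have "(\<lambda>x. (v x, 0)) \<in> L2 \<Omega>" "(\<lambda>x. (0, G x)) \<in> L2 \<Omega>"
    using L2_bounded_linear_image[OF bounded_linear_Pair[OF bounded_linear_ident bounded_linear_zero] assms(1)]
      L2_bounded_linear_image[OF bounded_linear_Pair[OF bounded_linear_zero bounded_linear_ident] assms(2)]
    by auto
  from L2_add[OF this] show ?thesis by (simp add: plus_fun_def)
qed

lemma L2_inner_Pair:
  assumes "F \<in> L2 \<Omega>" "F' \<in> L2 \<Omega>"
  shows "L2_inner \<Omega> F F' = L2_inner \<Omega> (\<lambda>x. fst (F x)) (\<lambda>x. fst (F' x))
      + L2_inner \<Omega> (\<lambda>x. snd (F x)) (\<lambda>x. snd (F' x))"
  unfolding L2_inner_def inner_prod_def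
  by (intro Bochner_Integration.integral_add L2_integrable_inner L2_fst L2_snd assms)

lemma L2_sum: "(\<And>i. i \<in> I \<Longrightarrow> f i \<in> L2 \<Omega>) \<Longrightarrow> (\<lambda>x. \<Sum>i\<in>I. f i x) \<in> L2 \<Omega>"
proof (induction I rule: infinite_finite_induct)
  case (insert i I)
  then show ?case using L2_add[of "f i" \<Omega> "\<lambda>x. \<Sum>i\<in>I. f i x"] by (simp add: plus_fun_def)
qed (simp_all flip: zero_fun_def)

text \<open>The chosen gradient of a sum is the sum of the chosen gradients only up to a null set, so that
  calculations are carried out with an arbitrary weak gradient.\<close>
definition has_weak_grad ::
  "'a::euclidean_space set \<Rightarrow> ('a \<Rightarrow> real) \<Rightarrow> ('a \<Rightarrow> 'a) \<Rightarrow> bool" where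
  "has_weak_grad \<Omega> v G \<longleftrightarrow> v \<in> L2 \<Omega> \<and> G \<in> L2 \<Omega> \<and> is_weak_gradient \<Omega> v G"

lemma has_weak_gradD:
  assumes "has_weak_grad \<Omega> v G"
  shows "v \<in> L2 \<Omega>" "G \<in> L2 \<Omega>"
    "\<And>\<phi> i. \<phi> \<in> test_functions \<Omega> \<Longrightarrow> i \<in> Basis \<Longrightarrow>
      L2_inner \<Omega> v (partial_deriv i \<phi>) = - L2_inner \<Omega> (\<lambda>x. G x \<bullet> i) \<phi>"
  using assms by (auto simp: has_weak_grad_def is_weak_gradient_def)

lemma has_weak_grad_grad: "v \<in> H1 \<Omega> \<Longrightarrow> has_weak_grad \<Omega> v (grad \<Omega> v)"
  unfolding H1_def has_weak_grad_def grad_def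
  by (metis (mono_tags, lifting) mem_Collect_eq someI_ex)

lemma has_weak_grad_H1: "has_weak_grad \<Omega> v G \<Longrightarrow> v \<in> H1 \<Omega>"
  by (auto simp: has_weak_grad_def H1_def)

lemma H01_weak_grad: "v \<in> H01 \<Omega> \<Longrightarrow> has_weak_grad \<Omega> v (grad \<Omega> v)"
  by (simp add: H01_def has_weak_grad_grad)

lemma H01_L2: "v \<in> H01 \<Omega> \<Longrightarrow> v \<in> L2 \<Omega>"
  using H01_weak_grad has_weak_gradD(1) by blast

lemma grad_L2: "v \<in> H01 \<Omega> \<Longrightarrow> grad \<Omega> v \<in> L2 \<Omega>"
  using H01_weak_grad has_weak_gradD(2) by blast

lemma H01_approx:
  "v \<in> H01 \<Omega> \<Longrightarrow> \<epsilon> > 0 \<Longrightarrow> \<exists>\<phi>\<in>test_functions \<Omega>. H1_norm \<Omega> (v - \<phi>) < \<epsilon>"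
  by (simp add: H01_def)

context
  fixes \<Omega> :: "'a::euclidean_space set"
  assumes \<Omega>: "open \<Omega>"
begin

lemma sets_lebesgue_domain: "\<Omega> \<in> sets lebesgue"
  using \<Omega> by (simp add: sets_completionI_sets)

lemma has_weak_grad_add:
  assumes "has_weak_grad \<Omega> v G" "has_weak_grad \<Omega> w H"
  shows "has_weak_grad \<Omega> (v + w) (G + H)"
proof -
  note v = has_weak_gradD[OF assms(1)] and w = has_weak_gradD[OF assms(2)]
  have "L2_inner \<Omega> (v + w) (partial_deriv i \<phi>) = - L2_inner \<Omega> (\<lambda>x. (G + H) x \<bullet> i) \<phi>"
    if \<phi>: "\<phi> \<in> test_functions \<Omega>" and i: "i \<in> Basis" for \<phi> i
  proof -
    have "(\<lambda>x. (G + H) x \<bullet> i) = (\<lambda>x. G x \<bullet> i) + (\<lambda>x. H x \<bullet> i)"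
      by (simp add: fun_eq_iff inner_add_left)
    then show ?thesis
      using v w \<phi> i test_function_L2[OF sets_lebesgue_domain \<phi>] test_function_partial_L2[OF sets_lebesgue_domain \<phi> i]
      by (simp add: L2_inner_add_left L2_component)
  qed
  then show ?thesis
    using v w by (auto simp: has_weak_grad_def is_weak_gradient_def)
qed

lemma has_weak_grad_scaleR:
  assumes "has_weak_grad \<Omega> v G"
  shows "has_weak_grad \<Omega> (c *\<^sub>R v) (c *\<^sub>R G)"
proof -
  note v = has_weak_gradD[OF assms(1)]
  have "L2_inner \<Omega> (c *\<^sub>R v) (partial_deriv i \<phi>) = - L2_inner \<Omega> (\<lambda>x. (c *\<^sub>R G) x \<bullet> i) \<phi>"
    if \<phi>: "\<phi> \<in> test_functions \<Omega>" and i: "i \<in> Basis" for \<phi> i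
  proof -
    have "(\<lambda>x. (c *\<^sub>R G) x \<bullet> i) = c *\<^sub>R (\<lambda>x. G x \<bullet> i)"
      by (simp add: fun_eq_iff scaleR_fun_def)
    then show ?thesis
      using v(3)[OF \<phi> i] by (simp add: L2_inner_scaleR_left)
  qed
  then show ?thesis
    using v by (auto simp: has_weak_grad_def is_weak_gradient_def)
qed

lemma has_weak_grad_diff:
  assumes "has_weak_grad \<Omega> v G" "has_weak_grad \<Omega> w H"
  shows "has_weak_grad \<Omega> (v - w) (G - H)"
  using has_weak_grad_add[OF assms(1) has_weak_grad_scaleR[OF assms(2), of "-1"]] by simp

lemma has_weak_grad_unique:
  assumes "has_weak_grad \<Omega> v G" "has_weak_grad \<Omega> v H"
  shows "AE x in lebesgue_on \<Omega>. G x = H x"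
proof -
  note G = has_weak_gradD[OF assms(1)] and H = has_weak_gradD[OF assms(2)]
  have "AE x in lebesgue_on \<Omega>. G x \<bullet> i - H x \<bullet> i = 0" if i: "i \<in> Basis" for i
  proof (rule test_functions_fundamental_lemma[OF \<Omega>])
    show "(\<lambda>x. G x \<bullet> i - H x \<bullet> i) \<in> L2 \<Omega>"
      using L2_component[OF L2_diff[OF G(2) H(2)], of i] by (simp add: inner_diff_left)
    fix \<phi> assume \<phi>: "\<phi> \<in> test_functions \<Omega>"
    have "(\<lambda>x. G x \<bullet> i - H x \<bullet> i) = (\<lambda>x. G x \<bullet> i) - (\<lambda>x. H x \<bullet> i)" by (simp add: fun_eq_iff)
    then show "L2_inner \<Omega> (\<lambda>x. G x \<bullet> i - H x \<bullet> i) \<phi> = 0"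
      using G(3)[OF \<phi> i] H(3)[OF \<phi> i] test_function_L2[OF sets_lebesgue_domain \<phi>] G H
      by (simp add: L2_inner_diff_left L2_component)
  qed
  then have "AE x in lebesgue_on \<Omega>. \<forall>i\<in>Basis. G x \<bullet> i - H x \<bullet> i = 0"
    by (intro AE_finite_allI) auto
  then show ?thesis
    by eventually_elim (auto intro: euclidean_eqI)
qed

lemma AE_grad_eq: "has_weak_grad \<Omega> v G \<Longrightarrow> AE x in lebesgue_on \<Omega>. grad \<Omega> v x = G x"
  using has_weak_grad_unique has_weak_grad_grad has_weak_grad_H1 by blast

lemma test_function_has_weak_grad:
  assumes "\<phi> \<in> test_functions \<Omega>"
  shows "has_weak_grad \<Omega> \<phi> (\<lambda>x. \<Sum>i\<in>Basis. partial_deriv i \<phi> x *\<^sub>R i)"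
proof -
  have "(\<lambda>x. partial_deriv i \<phi> x *\<^sub>R i) \<in> L2 \<Omega>" if "i \<in> Basis" for i
    using L2_bounded_linear_image[OF bounded_linear_scaleR_left
        test_function_partial_L2[OF sets_lebesgue_domain assms that]] .
  then have "(\<lambda>x. \<Sum>i\<in>Basis. partial_deriv i \<phi> x *\<^sub>R i) \<in> L2 \<Omega>"
    by (rule L2_sum)
  moreover have "(\<lambda>x. (\<Sum>j\<in>Basis. partial_deriv j \<phi> x *\<^sub>R j) \<bullet> i) = partial_deriv i \<phi>"
    if "i \<in> Basis" for i
    using that by (simp add: fun_eq_iff inner_sum_left_Basis)
  ultimately show ?thesis
    unfolding has_weak_grad_def is_weak_gradient_def
    using assms by (simp add: test_function_L2[OF sets_lebesgue_domain]
        test_function_integration_by_parts[OF sets_lebesgue_domain])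
qed

lemma H1_norm_eq:
  assumes "has_weak_grad \<Omega> v G"
  shows "H1_norm \<Omega> v = L2_norm \<Omega> (\<lambda>x. (v x, G x))"
proof -
  note v = has_weak_gradD(1,2)[OF assms]
  have "L2_norm \<Omega> (grad \<Omega> v) = L2_norm \<Omega> G"
    using AE_grad_eq[OF assms] v has_weak_gradD(2)[OF has_weak_grad_grad[OF has_weak_grad_H1[OF assms]]]
    by (intro L2_norm_AE_cong)
  then have "(H1_norm \<Omega> v)\<^sup>2 = (L2_norm \<Omega> (\<lambda>x. (v x, G x)))\<^sup>2"
    using L2_inner_Pair[OF L2_Pair[OF v] L2_Pair[OF v]]
    by (simp add: H1_norm_def L2_norm_power2)
  then show ?thesis
    by (simp add: H1_norm_def)
qed

lemma H1_norm_add: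
  assumes "has_weak_grad \<Omega> v G" "has_weak_grad \<Omega> w H"
  shows "H1_norm \<Omega> (v + w) \<le> H1_norm \<Omega> v + H1_norm \<Omega> w"
proof -
  have "(\<lambda>x. ((v + w) x, (G + H) x)) = (\<lambda>x. (v x, G x)) + (\<lambda>x. (w x, H x))"
    by (simp add: fun_eq_iff)
  then show ?thesis
    unfolding H1_norm_eq[OF assms(1)] H1_norm_eq[OF assms(2)] H1_norm_eq[OF has_weak_grad_add[OF assms]]
    using assms by (simp add: L2_norm_triangle L2_Pair has_weak_grad_def)
qed

lemma H1_norm_scaleR:
  assumes "has_weak_grad \<Omega> v G"
  shows "H1_norm \<Omega> (c *\<^sub>R v) = \<bar>c\<bar> * H1_norm \<Omega> v"
proof -
  have "(\<lambda>x. ((c *\<^sub>R v) x, (c *\<^sub>R G) x)) = c *\<^sub>R (\<lambda>x. (v x, G x))"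
    by (simp add: fun_eq_iff scaleR_fun_def)
  then show ?thesis
    unfolding H1_norm_eq[OF assms(1)] H1_norm_eq[OF has_weak_grad_scaleR[OF assms]]
    by (simp add: L2_norm_def L2_inner_scaleR_left L2_inner_scaleR_right real_sqrt_mult
        flip: mult.assoc)
qed

lemma H01_add:
  assumes "v \<in> H01 \<Omega>" "w \<in> H01 \<Omega>"
  shows "v + w \<in> H01 \<Omega>"
proof -
  note v = H01_weak_grad[OF assms(1)] and w = H01_weak_grad[OF assms(2)]
  have "\<exists>\<phi>\<in>test_functions \<Omega>. H1_norm \<Omega> (v + w - \<phi>) < \<epsilon>" if "\<epsilon> > 0" for \<epsilon>
  proof -
    obtain \<phi> \<psi> where \<phi>: "\<phi> \<in> test_functions \<Omega>" "H1_norm \<Omega> (v - \<phi>) < \<epsilon> / 2"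
      and \<psi>: "\<psi> \<in> test_functions \<Omega>" "H1_norm \<Omega> (w - \<psi>) < \<epsilon> / 2"
      using H01_approx[OF assms(1), of "\<epsilon> / 2"] H01_approx[OF assms(2), of "\<epsilon> / 2"] \<open>\<epsilon> > 0\<close>
      by auto
    have "H1_norm \<Omega> ((v - \<phi>) + (w - \<psi>)) < \<epsilon>"
      using H1_norm_add[OF has_weak_grad_diff[OF v test_function_has_weak_grad[OF \<phi>(1)]]
          has_weak_grad_diff[OF w test_function_has_weak_grad[OF \<psi>(1)]]] \<phi>(2) \<psi>(2)
      by linarith
    then show ?thesis
      using test_functions_add[OF \<phi>(1) \<psi>(1)]
      by (intro bexI[of _ "\<phi> + \<psi>"]) (simp_all add: algebra_simps)
  qed
  then show ?thesis
    unfolding H01_def using has_weak_grad_H1[OF has_weak_grad_add[OF v w]] by blast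
qed

lemma H01_scaleR:
  assumes "v \<in> H01 \<Omega>"
  shows "c *\<^sub>R v \<in> H01 \<Omega>"
proof -
  note v = H01_weak_grad[OF assms(1)]
  have "\<exists>\<phi>\<in>test_functions \<Omega>. H1_norm \<Omega> (c *\<^sub>R v - \<phi>) < \<epsilon>" if "\<epsilon> > 0" for \<epsilon>
  proof -
    have "\<epsilon> / (\<bar>c\<bar> + 1) > 0" using \<open>\<epsilon> > 0\<close> by (simp add: add_nonneg_pos)
    then obtain \<phi> where \<phi>: "\<phi> \<in> test_functions \<Omega>" "H1_norm \<Omega> (v - \<phi>) < \<epsilon> / (\<bar>c\<bar> + 1)"
      using H01_approx[OF assms] by blast
    have "H1_norm \<Omega> (c *\<^sub>R v - c *\<^sub>R \<phi>) = \<bar>c\<bar> * H1_norm \<Omega> (v - \<phi>)"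
      using H1_norm_scaleR[OF has_weak_grad_diff[OF v test_function_has_weak_grad[OF \<phi>(1)]], of c]
      by (simp add: scaleR_diff_right)
    also have "\<dots> \<le> (\<bar>c\<bar> + 1) * H1_norm \<Omega> (v - \<phi>)"
      by (intro mult_right_mono) (auto simp: H1_norm_def)
    also have "\<dots> < \<epsilon>"
      using \<phi>(2) by (simp add: pos_less_divide_eq add_nonneg_pos mult.commute)
    finally show ?thesis
      using test_functions_scaleR[OF \<phi>(1)] by blast
  qed
  then show ?thesis
    unfolding H01_def using has_weak_grad_H1[OF has_weak_grad_scaleR[OF v]] by blast
qed

lemma H01_minus: "v \<in> H01 \<Omega> \<Longrightarrow> - v \<in> H01 \<Omega>"
  using H01_scaleR[of v "-1"] by simp

lemma H01_diff: "v \<in> H01 \<Omega> \<Longrightarrow> w \<in> H01 \<Omega> \<Longrightarrow> v - w \<in> H01 \<Omega>"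
  using H01_add[of v "- w"] H01_minus[of w] by simp

lemma has_weak_grad_0: "has_weak_grad \<Omega> 0 0"
  by (simp add: has_weak_grad_def is_weak_gradient_def flip: zero_fun_def)

lemma H1_norm_0: "H1_norm \<Omega> 0 = 0"
proof -
  have "(\<lambda>x. (0 x, 0 x)) = (0 :: 'a \<Rightarrow> real \<times> 'a)" by (simp add: fun_eq_iff zero_prod_def)
  then show ?thesis
    using H1_norm_eq[OF has_weak_grad_0] by (simp add: L2_norm_def)
qed

lemma test_functions_H01: "\<phi> \<in> test_functions \<Omega> \<Longrightarrow> \<phi> \<in> H01 \<Omega>"
  unfolding H01_def
  using has_weak_grad_H1[OF test_function_has_weak_grad] H1_norm_0
  by (auto intro!: bexI[of _ \<phi>])

lemma H01_0: "0 \<in> H01 \<Omega>"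
proof -
  have "C_times k (\<lambda>x::'a. 0)" for k
    by (intro flat_exp_algebra_C_times flat_exp_algebra.const)
  then have "(\<lambda>x. 0) \<in> test_functions \<Omega>"
    unfolding test_functions_def by (auto intro!: exI[of _ "{}"])
  then show ?thesis using test_functions_H01 by (simp add: zero_fun_def)
qed

text \<open>Weak gradients pass to limits, so that the pairs \<open>(v, \<nabla>v)\<close> form a closed subspace.\<close>

lemma H01_graph_closed:
  assumes X: "\<And>k. (\<lambda>x. fst (X k x)) \<in> H01 \<Omega>" "\<And>k. has_weak_grad \<Omega> (\<lambda>x. fst (X k x)) (\<lambda>x. snd (X k x))"
    and P: "P \<in> L2 \<Omega>" and lim: "(\<lambda>k::nat. L2_norm \<Omega> (X k - P)) \<longlonglongrightarrow> 0"
  shows "(\<lambda>x. fst (P x)) \<in> H01 \<Omega>" "has_weak_grad \<Omega> (\<lambda>x. fst (P x)) (\<lambda>x. snd (P x))"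
proof -
  let ?p = "\<lambda>x. fst (P x)" and ?q = "\<lambda>x. snd (P x)"
  note wX = has_weak_gradD[OF X(2)]
  have XL: "X k \<in> L2 \<Omega>" for k
    using L2_Pair[OF wX(1,2)[of k]] by simp
  have fst_le: "L2_norm \<Omega> (\<lambda>x. fst (F x)) \<le> L2_norm \<Omega> F" and
    snd_le: "L2_norm \<Omega> (\<lambda>x. snd (F x)) \<le> L2_norm \<Omega> F" if "F \<in> L2 \<Omega>" for F :: "'a \<Rightarrow> real \<times> 'a"
    unfolding L2_norm_def L2_inner_Pair[OF that that] by simp_all
  have lim_fst: "(\<lambda>k. L2_norm \<Omega> ((\<lambda>x. fst (X k x)) - ?p)) \<longlonglongrightarrow> 0"
    using fst_le[OF L2_diff[OF XL P]]
    by (intro tendsto_sandwich[OF _ _ tendsto_const lim]) (auto simp: fun_diff_def)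
  have lim_snd: "(\<lambda>k. L2_norm \<Omega> ((\<lambda>x. snd (X k x)) - ?q)) \<longlonglongrightarrow> 0"
    using snd_le[OF L2_diff[OF XL P]]
    by (intro tendsto_sandwich[OF _ _ tendsto_const lim]) (auto simp: fun_diff_def)
  show weak: "has_weak_grad \<Omega> ?p ?q"
    unfolding has_weak_grad_def is_weak_gradient_def
  proof (intro conjI ballI L2_fst L2_snd P)
    fix \<phi> and i :: 'a assume \<phi>: "\<phi> \<in> test_functions \<Omega>" and i: "i \<in> Basis"
    have "(\<lambda>k. L2_inner \<Omega> (\<lambda>x. fst (X k x)) (partial_deriv i \<phi>)) \<longlonglongrightarrow> L2_inner \<Omega> ?p (partial_deriv i \<phi>)"
      by (rule L2_inner_tendsto[OF wX(1) L2_fst[OF P] test_function_partial_L2[OF sets_lebesgue_domain \<phi> i] lim_fst])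
    moreover have "(\<lambda>k. - L2_inner \<Omega> (\<lambda>x. snd (X k x) \<bullet> i) \<phi>) \<longlonglongrightarrow> - L2_inner \<Omega> (\<lambda>x. ?q x \<bullet> i) \<phi>"
    proof (rule tendsto_minus)
      have "L2_inner \<Omega> (\<lambda>x. G x \<bullet> i) \<phi> = L2_inner \<Omega> G (\<lambda>x. \<phi> x *\<^sub>R i)" for G :: "'a \<Rightarrow> 'a"
        by (simp add: L2_inner_def mult.commute)
      then show "(\<lambda>k. L2_inner \<Omega> (\<lambda>x. snd (X k x) \<bullet> i) \<phi>) \<longlonglongrightarrow> L2_inner \<Omega> (\<lambda>x. ?q x \<bullet> i) \<phi>"
        using L2_inner_tendsto[OF wX(2) L2_snd[OF P]
            L2_bounded_linear_image[OF bounded_linear_scaleR_left test_function_L2[OF sets_lebesgue_domain \<phi>]] lim_snd]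
        by simp
    qed
    ultimately show "L2_inner \<Omega> ?p (partial_deriv i \<phi>) = - L2_inner \<Omega> (\<lambda>x. ?q x \<bullet> i) \<phi>"
      using wX(3)[OF \<phi> i] LIMSEQ_unique by simp
  qed
  have "\<exists>\<phi>\<in>test_functions \<Omega>. H1_norm \<Omega> (?p - \<phi>) < \<epsilon>" if "\<epsilon> > 0" for \<epsilon>
  proof -
    have "\<forall>\<^sub>F k in sequentially. L2_norm \<Omega> (X k - P) < \<epsilon> / 2"
      using order_tendstoD(2)[OF lim, of "\<epsilon> / 2"] \<open>\<epsilon> > 0\<close> by simp
    then obtain k where k: "L2_norm \<Omega> (X k - P) < \<epsilon> / 2"
      by (auto simp: eventually_sequentially)
    let ?v = "\<lambda>x. fst (X k x)"
    obtain \<phi> where \<phi>: "\<phi> \<in> test_functions \<Omega>" "H1_norm \<Omega> (?v - \<phi>) < \<epsilon> / 2"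
      using H01_approx[OF X(1), of "\<epsilon> / 2"] \<open>\<epsilon> > 0\<close> by auto
    have "(\<lambda>x. ((?p - ?v) x, (?q - (\<lambda>x. snd (X k x))) x)) = - (X k - P)"
      by (simp add: fun_eq_iff prod_eq_iff)
    then have "H1_norm \<Omega> (?p - ?v) = L2_norm \<Omega> (X k - P)"
      using H1_norm_eq[OF has_weak_grad_diff[OF weak X(2)]] by (simp only: L2_norm_minus)
    moreover have "H1_norm \<Omega> ((?p - ?v) + (?v - \<phi>)) \<le> H1_norm \<Omega> (?p - ?v) + H1_norm \<Omega> (?v - \<phi>)"
      by (rule H1_norm_add[OF has_weak_grad_diff[OF weak X(2)]
            has_weak_grad_diff[OF X(2) test_function_has_weak_grad[OF \<phi>(1)]]])
    moreover have "(?p - ?v) + (?v - \<phi>) = ?p - \<phi>" by simp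
    ultimately show ?thesis using k \<phi> by (intro bexI[of _ \<phi>]) auto
  qed
  then show "?p \<in> H01 \<Omega>"
    unfolding H01_def using has_weak_grad_H1[OF weak] by blast
qed

text \<open>Project \<open>(w, G)\<close> onto the closed subspace of the pairs \<open>(v, \<nabla>v)\<close>. The residual \<open>(a, \<tau>)\<close>
  satisfies \<open>div \<tau> = a\<close> precisely because it is orthogonal to that subspace; by hypothesis it is then
  orthogonal to \<open>(w, G)\<close> as well, hence to itself.\<close>

theorem H01_if_orthogonal_to_divergences:
  assumes w: "w \<in> L2 \<Omega>" and G: "G \<in> L2 \<Omega>"
    and orth: "\<And>a \<tau>. a \<in> L2 \<Omega> \<Longrightarrow> \<tau> \<in> L2 \<Omega> \<Longrightarrow>
      (\<And>v. v \<in> H01 \<Omega> \<Longrightarrow> L2_inner \<Omega> a v + L2_inner \<Omega> \<tau> (grad \<Omega> v) = 0) \<Longrightarrow>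
      L2_inner \<Omega> w a + L2_inner \<Omega> G \<tau> = 0"
  shows "w \<in> H01 \<Omega>" "AE x in lebesgue_on \<Omega>. grad \<Omega> w x = G x"
proof -
  define V where "V = {F. (\<lambda>x. fst (F x)) \<in> H01 \<Omega> \<and> has_weak_grad \<Omega> (\<lambda>x. fst (F x)) (\<lambda>x. snd (F x))}"
  let ?W = "\<lambda>x. (w x, G x)"
  have VL: "V \<subseteq> L2 \<Omega>"
  proof
    fix F assume "F \<in> V"
    then show "F \<in> L2 \<Omega>"
      using L2_Pair[OF has_weak_gradD(1,2)[of \<Omega> "\<lambda>x. fst (F x)" "\<lambda>x. snd (F x)"]] by (simp add: V_def)
  qed
  have WL: "?W \<in> L2 \<Omega>" by (rule L2_Pair[OF w G])
  obtain X P where X: "\<And>k. X k \<in> V" and P: "P \<in> L2 \<Omega>" "(\<lambda>k::nat. L2_norm \<Omega> (X k - P)) \<longlonglongrightarrow> 0"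
    and res: "\<And>F. F \<in> V \<Longrightarrow> L2_inner \<Omega> (?W - P) F = 0"
  proof (rule L2_projection[OF VL _ _ _ WL])
    show "0 \<in> V" using H01_0 has_weak_grad_0 by (simp add: V_def zero_fun_def)
    show "F + F' \<in> V" if "F \<in> V" "F' \<in> V" for F F'
      using that H01_add has_weak_grad_add unfolding V_def by (fastforce simp: plus_fun_def)
    show "c *\<^sub>R F \<in> V" if "F \<in> V" for c F
      using that H01_scaleR has_weak_grad_scaleR unfolding V_def by (fastforce simp: scaleR_fun_def)
  qed blast
  let ?p = "\<lambda>x. fst (P x)" and ?q = "\<lambda>x. snd (P x)"
  have p: "?p \<in> H01 \<Omega>" "has_weak_grad \<Omega> ?p ?q"
    using H01_graph_closed[OF _ _ P] X by (auto simp: V_def)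
  let ?a = "w - ?p" and ?\<tau> = "G - ?q"
  have aL: "?a \<in> L2 \<Omega>" and \<tau>L: "?\<tau> \<in> L2 \<Omega>"
    using w G P(1) by (auto intro: L2_fst L2_snd)
  have resP: "L2_inner \<Omega> (?W - P) F = L2_inner \<Omega> ?a (\<lambda>x. fst (F x)) + L2_inner \<Omega> ?\<tau> (\<lambda>x. snd (F x))"
    if "F \<in> L2 \<Omega>" for F
    using L2_inner_Pair[OF L2_diff[OF WL P(1)] that] by (simp add: fun_diff_def)
  have "L2_inner \<Omega> ?a v + L2_inner \<Omega> ?\<tau> (grad \<Omega> v) = 0" if "v \<in> H01 \<Omega>" for v
  proof -
    have "(\<lambda>x. (v x, grad \<Omega> v x)) \<in> V"
      using that H01_weak_grad[OF that] by (simp add: V_def)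
    then show ?thesis
      using res[of "\<lambda>x. (v x, grad \<Omega> v x)"] resP[of "\<lambda>x. (v x, grad \<Omega> v x)"] VL by auto
  qed
  from orth[OF aL \<tau>L this] have "L2_inner \<Omega> (?W - P) ?W = 0"
    using resP[OF WL] by (simp add: L2_inner_commute[of \<Omega> w] L2_inner_commute[of \<Omega> G])
  moreover have "P \<in> V" using p by (simp add: V_def)
  ultimately have "L2_inner \<Omega> (?W - P) (?W - P) = 0"
    using res[of P] WL P(1) by (simp add: L2_inner_diff_right L2_diff)
  then have eq: "AE x in lebesgue_on \<Omega>. ?W x = P x"
    using L2_inner_self_eq_0_iff[OF L2_diff[OF WL P(1)]] by simp
  have "L2_norm \<Omega> (P - ?W) = 0"
  proof -
    have "L2_inner \<Omega> (- (?W - P)) (- (?W - P)) = 0"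
      using \<open>L2_inner \<Omega> (?W - P) (?W - P) = 0\<close> by (simp only: L2_inner_minus_left L2_inner_minus_right minus_zero)
    then show ?thesis by (simp add: L2_norm_def)
  qed
  then have "w \<in> H01 \<Omega>" "has_weak_grad \<Omega> w G"
    using H01_graph_closed[of "\<lambda>k. P" ?W] p WL by auto
  then show "w \<in> H01 \<Omega>" "AE x in lebesgue_on \<Omega>. grad \<Omega> w x = G x"
    using AE_grad_eq by auto
qed

end


section \<open>The first-order system\<close>

text \<open>Arbitrary representatives \<open>G\<close> of \<open>\<nabla>u\<close> and \<open>d\<close> of \<open>div \<sigma> + \<lambda>\<close>: unlike the chosen ones, these can be
  added and scaled together with the triple.\<close>
definition U_rep ::
  "'a::euclidean_space set \<Rightarrow> 'a triple \<Rightarrow> ('a \<Rightarrow> 'a) \<Rightarrow> ('a \<Rightarrow> real) \<Rightarrow> bool" where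
  "U_rep \<Omega> = (\<lambda>(u, \<sigma>, l) G d. u \<in> H01 \<Omega> \<and> has_weak_grad \<Omega> u G \<and> \<sigma> \<in> L2 \<Omega> \<and> l \<in> Hm1 \<Omega> \<and>
     represents \<Omega> d (weak_div \<Omega> \<sigma> + l))"

lemma U_repD:
  assumes "U_rep \<Omega> (u, \<sigma>, l) G d"
  shows "u \<in> H01 \<Omega>" "has_weak_grad \<Omega> u G" "\<sigma> \<in> L2 \<Omega>" "l \<in> Hm1 \<Omega>"
    "represents \<Omega> d (weak_div \<Omega> \<sigma> + l)" "G \<in> L2 \<Omega>" "d \<in> L2 \<Omega>"
  using assms by (auto simp: U_rep_def has_weak_grad_def represents_def)

lemma represents_iff:
  "represents \<Omega> d (weak_div \<Omega> \<sigma> + l) \<longleftrightarrow>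
     d \<in> L2 \<Omega> \<and> (\<forall>v\<in>H01 \<Omega>. l v = L2_inner \<Omega> d v + L2_inner \<Omega> \<sigma> (grad \<Omega> v))"
  by (auto simp: represents_def weak_div_def)

lemma Hm1_add_arg: "l \<in> Hm1 \<Omega> \<Longrightarrow> v \<in> H01 \<Omega> \<Longrightarrow> w \<in> H01 \<Omega> \<Longrightarrow> l (v + w) = l v + l w"
  by (simp add: Hm1_def)

lemma Hm1_scaleR_arg: "l \<in> Hm1 \<Omega> \<Longrightarrow> v \<in> H01 \<Omega> \<Longrightarrow> l (c *\<^sub>R v) = c * l v"
  by (simp add: Hm1_def)

lemma Hm1_add:
  assumes "l \<in> Hm1 \<Omega>" "m \<in> Hm1 \<Omega>"
  shows "l + m \<in> Hm1 \<Omega>"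
proof -
  obtain C D where "\<forall>v\<in>H01 \<Omega>. \<bar>l v\<bar> \<le> C * H1_norm \<Omega> v" "\<forall>v\<in>H01 \<Omega>. \<bar>m v\<bar> \<le> D * H1_norm \<Omega> v"
    using assms by (auto simp: Hm1_def)
  then have "\<forall>v\<in>H01 \<Omega>. \<bar>l v + m v\<bar> \<le> (C + D) * H1_norm \<Omega> v"
    by (auto simp: distrib_right intro: order_trans[OF abs_triangle_ineq] add_mono)
  then have "\<exists>C. \<forall>v\<in>H01 \<Omega>. \<bar>(l + m) v\<bar> \<le> C * H1_norm \<Omega> v"
    unfolding plus_fun_def by blast
  with assms show ?thesis by (auto simp: Hm1_def algebra_simps)
qed

lemma Hm1_minus: "l \<in> Hm1 \<Omega> \<Longrightarrow> - l \<in> Hm1 \<Omega>"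
  by (auto simp: Hm1_def)

lemma Hm1_0: "0 \<in> Hm1 \<Omega>"
  by (auto simp: Hm1_def intro!: exI[of _ 0])

lemma H1_norm_ge: "L2_norm \<Omega> v \<le> H1_norm \<Omega> v"
  unfolding H1_norm_def by (rule real_le_rsqrt) simp

context
  fixes \<Omega> :: "'a::euclidean_space set"
  assumes \<Omega>: "open \<Omega>"
begin

lemma Hm1_diff_arg:
  assumes "l \<in> Hm1 \<Omega>" "v \<in> H01 \<Omega>" "w \<in> H01 \<Omega>"
  shows "l (v - w) = l v - l w"
  using Hm1_add_arg[OF assms(1,2) H01_scaleR[OF \<Omega> assms(3)], of "-1"] Hm1_scaleR_arg[OF assms(1,3), of "-1"]
  by simp

lemma L2_inner_Hm1:
  assumes p: "p \<in> L2 \<Omega>"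
  shows "L2_inner \<Omega> p \<in> Hm1 \<Omega>"
proof -
  have "\<bar>L2_inner \<Omega> p v\<bar> \<le> L2_norm \<Omega> p * H1_norm \<Omega> v" if "v \<in> H01 \<Omega>" for v
    using L2_Cauchy_Schwarz[OF p H01_L2[OF that]] mult_left_mono[OF H1_norm_ge L2_norm_nonneg]
    by (rule order_trans)
  then show ?thesis
    using p H01_L2[of _ \<Omega>] by (auto simp: Hm1_def L2_inner_add_right L2_inner_scaleR_right)
qed

lemma L2_inner_grad_eq:
  assumes "\<sigma> \<in> L2 \<Omega>" "v \<in> H01 \<Omega>" "has_weak_grad \<Omega> v H"
  shows "L2_inner \<Omega> \<sigma> (grad \<Omega> v) = L2_inner \<Omega> \<sigma> H"
  using assms AE_grad_eq[OF \<Omega> assms(3)] grad_L2[OF assms(2)] has_weak_gradD(2)[OF assms(3)]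
  by (intro L2_inner_AE_cong) auto

lemma U_rep_pairing:
  assumes "U_rep \<Omega> (u, \<sigma>, l) G d" "v \<in> H01 \<Omega>" "has_weak_grad \<Omega> v H"
  shows "l v = L2_inner \<Omega> d v + L2_inner \<Omega> \<sigma> H"
  using U_repD[OF assms(1)] assms(2,3) L2_inner_grad_eq by (simp add: represents_iff)

lemma U_rep_add:
  assumes x: "U_rep \<Omega> x G d" and y: "U_rep \<Omega> y H e"
  shows "U_rep \<Omega> (x + y) (G + H) (d + e)"
proof -
  obtain u \<sigma> l v \<tau> m where xy: "x = (u, \<sigma>, l)" "y = (v, \<tau>, m)" by (metis prod_cases3)
  note X = U_repD[OF x[unfolded xy]] and Y = U_repD[OF y[unfolded xy]]
  have "represents \<Omega> (d + e) (weak_div \<Omega> (\<sigma> + \<tau>) + (l + m))"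
    using X Y H01_L2[of _ \<Omega>] grad_L2[of _ \<Omega>] by (auto simp: represents_iff L2_inner_add_left)
  with X Y show ?thesis
    unfolding xy by (auto simp: U_rep_def H01_add[OF \<Omega>] has_weak_grad_add[OF \<Omega>] Hm1_add)
qed

lemma U_rep_minus:
  assumes x: "U_rep \<Omega> x G d"
  shows "U_rep \<Omega> (- x) (- G) (- d)"
proof -
  obtain u \<sigma> l where xy: "x = (u, \<sigma>, l)" by (metis prod_cases3)
  note X = U_repD[OF x[unfolded xy]]
  have "represents \<Omega> (- d) (weak_div \<Omega> (- \<sigma>) + (- l))"
    using X(5,7) unfolding represents_iff by (auto simp: L2_inner_minus_left)
  with X show ?thesis
    unfolding xy using has_weak_grad_scaleR[OF \<Omega> X(2), of "-1"]
    by (auto simp: U_rep_def H01_minus[OF \<Omega>] Hm1_minus)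
qed

lemma U_rep_diff:
  assumes "U_rep \<Omega> x G d" "U_rep \<Omega> y H e"
  shows "U_rep \<Omega> (x - y) (G - H) (d - e)"
  using U_rep_add[OF assms(1) U_rep_minus[OF assms(2)]] by simp

lemma U_rep_U_space: "U_rep \<Omega> x G d \<Longrightarrow> x \<in> U_space \<Omega>"
  by (cases x) (auto simp: U_rep_def U_space_def)

lemma U_space_rep: "(u, \<sigma>, l) \<in> U_space \<Omega> \<Longrightarrow> U_rep \<Omega> (u, \<sigma>, l) (grad \<Omega> u) (div_plus \<Omega> \<sigma> l)"
  unfolding U_space_def U_rep_def div_plus_def
  by (auto intro: H01_weak_grad someI[where P = "\<lambda>w. represents \<Omega> w (weak_div \<Omega> \<sigma> + l)"])

lemma U_spaceE:
  assumes "x \<in> U_space \<Omega>"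
  obtains G d where "U_rep \<Omega> x G d"
  using assms U_space_rep by (cases x) blast

lemma U_space_diff:
  assumes "x \<in> U_space \<Omega>" "y \<in> U_space \<Omega>"
  shows "x - y \<in> U_space \<Omega>"
  using assms U_rep_diff U_rep_U_space by (metis U_spaceE)

text \<open>\<open>L\<^sup>2\<close> representers of a functional on \<open>H\<^sub>0\<^sup>1\<close> are unique since test functions lie in \<open>H\<^sub>0\<^sup>1\<close>.\<close>

lemma represents_unique:
  assumes "represents \<Omega> d l" "represents \<Omega> e l"
  shows "AE x in lebesgue_on \<Omega>. d x = e x"
proof -
  have "AE x in lebesgue_on \<Omega>. (d - e) x = 0"
  proof (rule test_functions_fundamental_lemma[OF \<Omega>])
    show "d - e \<in> L2 \<Omega>" using assms by (auto simp: represents_def)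
    show "L2_inner \<Omega> (d - e) \<phi> = 0" if "\<phi> \<in> test_functions \<Omega>" for \<phi>
      using assms test_functions_H01[OF \<Omega> that] H01_L2[of \<phi> \<Omega>]
      by (auto simp: represents_def L2_inner_diff_left)
  qed
  then show ?thesis by simp
qed

lemma U_rep_AE:
  assumes "U_rep \<Omega> (u, \<sigma>, l) G d"
  shows "AE x in lebesgue_on \<Omega>. grad \<Omega> u x = G x" "AE x in lebesgue_on \<Omega>. div_plus \<Omega> \<sigma> l x = d x"
    "grad \<Omega> u \<in> L2 \<Omega>" "div_plus \<Omega> \<sigma> l \<in> L2 \<Omega>"
proof -
  note x = U_repD[OF assms] and y = U_repD[OF U_space_rep[OF U_rep_U_space[OF assms]]]
  show "AE x in lebesgue_on \<Omega>. grad \<Omega> u x = G x" by (rule AE_grad_eq[OF \<Omega> x(2)])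
  show "AE x in lebesgue_on \<Omega>. div_plus \<Omega> \<sigma> l x = d x" by (rule represents_unique[OF y(5) x(5)])
  show "grad \<Omega> u \<in> L2 \<Omega>" "div_plus \<Omega> \<sigma> l \<in> L2 \<Omega>" using y by auto
qed

lemma a_form_eq:
  assumes x: "U_rep \<Omega> (u, \<sigma>, l) G d" and y: "U_rep \<Omega> (v, \<tau>, m) H e"
  shows "a_form \<Omega> \<beta> (u, \<sigma>, l) (v, \<tau>, m) =
    \<beta> * L2_inner \<Omega> d e + L2_inner \<Omega> (G - \<sigma>) (H - \<tau>) + (m u + l v) / 2"
proof -
  note X = U_repD[OF x] U_rep_AE[OF x] and Y = U_repD[OF y] U_rep_AE[OF y]
  have "L2_inner \<Omega> (div_plus \<Omega> \<sigma> l) (div_plus \<Omega> \<tau> m) = L2_inner \<Omega> d e"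
    using X Y by (intro L2_inner_AE_cong)
  moreover have "AE x in lebesgue_on \<Omega>. (grad \<Omega> u - \<sigma>) x = (G - \<sigma>) x"
    using X(8) by eventually_elim simp
  moreover have "AE x in lebesgue_on \<Omega>. (grad \<Omega> v - \<tau>) x = (H - \<tau>) x"
    using Y(8) by eventually_elim simp
  then have "L2_inner \<Omega> (grad \<Omega> u - \<sigma>) (grad \<Omega> v - \<tau>) = L2_inner \<Omega> (G - \<sigma>) (H - \<tau>)"
    using calculation(2) X Y by (intro L2_inner_AE_cong L2_diff)
  ultimately show ?thesis by (simp add: a_form_def)
qed

lemma F_form_eq:
  assumes y: "U_rep \<Omega> (v, \<tau>, m) H e" and f: "f \<in> L2 \<Omega>"
  shows "F_form \<Omega> \<beta> f g (v, \<tau>, m) = - \<beta> * L2_inner \<Omega> f e + m g / 2"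
proof -
  have "L2_inner \<Omega> f (div_plus \<Omega> \<tau> m) = L2_inner \<Omega> f e"
    using U_repD[OF y] U_rep_AE[OF y] f by (intro L2_inner_AE_cong) auto
  then show ?thesis by (simp add: F_form_def)
qed

lemma U_norm_eq:
  assumes x: "U_rep \<Omega> (u, \<sigma>, l) G d"
  shows "U_norm \<Omega> (u, \<sigma>, l) = sqrt ((L2_norm \<Omega> G)\<^sup>2 + (L2_norm \<Omega> \<sigma>)\<^sup>2 + (L2_norm \<Omega> d)\<^sup>2)"
proof -
  have "L2_norm \<Omega> (grad \<Omega> u) = L2_norm \<Omega> G" "L2_norm \<Omega> (div_plus \<Omega> \<sigma> l) = L2_norm \<Omega> d"
    using U_repD[OF x] U_rep_AE[OF x] by (auto intro: L2_norm_AE_cong)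
  then show ?thesis by (simp add: U_norm_def)
qed

lemma a_form_commute: "a_form \<Omega> \<beta> x y = a_form \<Omega> \<beta> y x"
  by (cases x; cases y) (simp add: a_form_def L2_inner_commute add.commute)

lemma a_form_diff_right:
  assumes "x \<in> U_space \<Omega>" "y \<in> U_space \<Omega>" "z \<in> U_space \<Omega>"
  shows "a_form \<Omega> \<beta> x (y - z) = a_form \<Omega> \<beta> x y - a_form \<Omega> \<beta> x z"
proof -
  obtain u \<sigma> l v \<tau> m v' \<tau>' m' where xyz: "x = (u, \<sigma>, l)" "y = (v, \<tau>, m)" "z = (v', \<tau>', m')"
    by (metis prod_cases3)
  obtain G d H e H' e' where
    rx: "U_rep \<Omega> (u, \<sigma>, l) G d" and ry: "U_rep \<Omega> (v, \<tau>, m) H e" and rz: "U_rep \<Omega> (v', \<tau>', m') H' e'"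
    using assms unfolding xyz by (metis U_spaceE)
  have ryz: "U_rep \<Omega> (v - v', \<tau> - \<tau>', m - m') (H - H') (e - e')"
    using U_rep_diff[OF ry rz] by simp
  note X = U_repD[OF rx] and Y = U_repD[OF ry] and Z = U_repD[OF rz]
  have *: "H - H' - (\<tau> - \<tau>') = (H - \<tau>) - (H' - \<tau>')" by simp
  have "L2_inner \<Omega> (G - \<sigma>) (H - H' - (\<tau> - \<tau>')) =
      L2_inner \<Omega> (G - \<sigma>) (H - \<tau>) - L2_inner \<Omega> (G - \<sigma>) (H' - \<tau>')"
    unfolding * using X Y Z by (intro L2_inner_diff_right L2_diff)
  moreover have "\<beta> * L2_inner \<Omega> d (e - e') = \<beta> * L2_inner \<Omega> d e - \<beta> * L2_inner \<Omega> d e'"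
    using X Y Z by (simp add: L2_inner_diff_right right_diff_distrib)
  moreover have "(m - m') u = m u - m' u" by simp
  ultimately have "a_form \<Omega> \<beta> (u, \<sigma>, l) (v - v', \<tau> - \<tau>', m - m') =
      a_form \<Omega> \<beta> (u, \<sigma>, l) (v, \<tau>, m) - a_form \<Omega> \<beta> (u, \<sigma>, l) (v', \<tau>', m')"
    unfolding a_form_eq[OF rx ry] a_form_eq[OF rx rz] a_form_eq[OF rx ryz]
      Hm1_diff_arg[OF X(4) Y(1) Z(1)] by argo
  then show ?thesis unfolding xyz by simp
qed

lemma a_form_diff_left:
  assumes "x \<in> U_space \<Omega>" "y \<in> U_space \<Omega>" "z \<in> U_space \<Omega>"
  shows "a_form \<Omega> \<beta> (x - y) z = a_form \<Omega> \<beta> x z - a_form \<Omega> \<beta> y z"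
  using a_form_diff_right[OF assms(3,1,2)] by (simp add: a_form_commute)

lemma F_form_diff:
  assumes "y \<in> U_space \<Omega>" "z \<in> U_space \<Omega>" and f: "f \<in> L2 \<Omega>"
  shows "F_form \<Omega> \<beta> f g (y - z) = F_form \<Omega> \<beta> f g y - F_form \<Omega> \<beta> f g z"
proof -
  obtain v \<tau> m v' \<tau>' m' where yz: "y = (v, \<tau>, m)" "z = (v', \<tau>', m')"
    by (metis prod_cases3)
  obtain H e H' e' where
    ry: "U_rep \<Omega> (v, \<tau>, m) H e" and rz: "U_rep \<Omega> (v', \<tau>', m') H' e'"
    using assms unfolding yz by (metis U_spaceE)
  have ryz: "U_rep \<Omega> (v - v', \<tau> - \<tau>', m - m') (H - H') (e - e')"
    using U_rep_diff[OF ry rz] by simp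
  show ?thesis
    unfolding yz using U_repD(7)[OF ry] U_repD(7)[OF rz] f
    by (simp add: F_form_eq[OF ry f] F_form_eq[OF rz f] F_form_eq[OF ryz f] L2_inner_diff_right
        field_simps)
qed

lemma L2_inner_le_mult:
  assumes "p \<in> L2 \<Omega>" "q \<in> L2 \<Omega>" "L2_norm \<Omega> p \<le> P" "L2_norm \<Omega> q \<le> Q"
  shows "\<bar>L2_inner \<Omega> p q\<bar> \<le> P * Q"
proof -
  have "0 \<le> P" using assms(3) L2_norm_nonneg order_trans by blast
  then have "L2_norm \<Omega> p * L2_norm \<Omega> q \<le> P * Q"
    using assms(3,4) by (intro mult_mono) auto
  with L2_Cauchy_Schwarz[OF assms(1,2)] show ?thesis by linarith
qed

text \<open>Let \<open>d = div \<sigma> + \<lambda>\<close> and let \<open>t, s, D\<close> be the norms of \<open>\<nabla>u, \<sigma>, d\<close>. Since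
  \<open>\<langle>\<lambda>, u\<rangle> = (d, u) + (\<sigma>, \<nabla>u)\<close>, the diagonal of the form is
  \<open>\<beta> D\<^sup>2 + t\<^sup>2 - (\<sigma>, \<nabla>u) + s\<^sup>2 + (d, u)\<close>. Friedrichs' inequality bounds the last term by
  \<open>C D t \<le> C\<^sup>2 D\<^sup>2 + t\<^sup>2 / 4\<close>, which is where the condition on \<open>\<beta>\<close> comes from; at least
  \<open>D\<^sup>2 + t\<^sup>2 / 4 + s\<^sup>2 / 2\<close> remains.\<close>

lemma a_form_coercive:
  assumes x: "x \<in> U_space \<Omega>"
    and friedrichs: "friedrichs_constant \<Omega> C" and \<beta>: "\<beta> \<ge> 1 + C\<^sup>2"
  shows "(U_norm \<Omega> x)\<^sup>2 \<le> 4 * a_form \<Omega> \<beta> x x"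
proof -
  obtain u \<sigma> l where xe: "x = (u, \<sigma>, l)" by (metis prod_cases3)
  define G d where "G = grad \<Omega> u" and "d = div_plus \<Omega> \<sigma> l"
  have r: "U_rep \<Omega> (u, \<sigma>, l) G d" unfolding G_def d_def using x xe U_space_rep by blast
  note X = U_repD[OF r]
  define t s D where "t = L2_norm \<Omega> G" and "s = L2_norm \<Omega> \<sigma>" and "D = L2_norm \<Omega> d"
  have nonneg: "t \<ge> 0" "s \<ge> 0" "D \<ge> 0" by (auto simp: t_def s_def D_def)
  have norm: "(U_norm \<Omega> x)\<^sup>2 = t\<^sup>2 + s\<^sup>2 + D\<^sup>2"
    unfolding xe U_norm_eq[OF r] t_def s_def D_def by simp
  have "L2_inner \<Omega> (G - \<sigma>) (G - \<sigma>) = t\<^sup>2 - 2 * L2_inner \<Omega> \<sigma> G + s\<^sup>2"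
    using L2_norm_diff_power2[OF X(6,3)] by (simp add: t_def s_def L2_norm_power2 L2_inner_commute)
  then have a: "a_form \<Omega> \<beta> x x = \<beta> * D\<^sup>2 + t\<^sup>2 - L2_inner \<Omega> \<sigma> G + s\<^sup>2 + L2_inner \<Omega> d u"
    unfolding xe a_form_eq[OF r r] using U_rep_pairing[OF r X(1,2)] by (simp add: D_def L2_norm_power2)
  have "\<bar>L2_inner \<Omega> \<sigma> G\<bar> \<le> s * t"
    unfolding s_def t_def using X by (intro L2_Cauchy_Schwarz)
  moreover have "2 * (s * t) \<le> s\<^sup>2 + t\<^sup>2" using sum_squares_bound[of s t] by simp
  moreover have "\<bar>L2_inner \<Omega> d u\<bar> \<le> D * L2_norm \<Omega> u"
    unfolding D_def using X H01_L2 by (intro L2_Cauchy_Schwarz) auto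
  moreover have "D * L2_norm \<Omega> u \<le> D * (C * t)"
    using friedrichs X(1) nonneg by (intro mult_left_mono) (auto simp: friedrichs_constant_def t_def G_def)
  moreover have "D * (C * t) \<le> C\<^sup>2 * D\<^sup>2 + t\<^sup>2 / 4"
    using zero_le_power2[of "C * D - t / 2"] by (simp add: power2_diff power_mult_distrib power_divide algebra_simps)
  moreover have "(1 + C\<^sup>2) * D\<^sup>2 \<le> \<beta> * D\<^sup>2" using \<beta> by (rule mult_right_mono) simp
  then have "D\<^sup>2 + C\<^sup>2 * D\<^sup>2 \<le> \<beta> * D\<^sup>2" by (simp add: distrib_right)
  moreover have "0 \<le> s\<^sup>2" "0 \<le> D\<^sup>2" by simp_all
  ultimately have "t\<^sup>2 / 4 + s\<^sup>2 / 4 + D\<^sup>2 / 4 \<le> a_form \<Omega> \<beta> x x"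
    unfolding a using zero_le_power2[of t] by linarith
  then show ?thesis unfolding norm by (simp add: field_simps)
qed

lemma a_form_bounded:
  assumes x: "x \<in> U_space \<Omega>" and y: "y \<in> U_space \<Omega>"
    and friedrichs: "friedrichs_constant \<Omega> C" and \<beta>: "\<beta> \<ge> 0"
  shows "\<bar>a_form \<Omega> \<beta> x y\<bar> \<le> (\<beta> + C + 5) * (U_norm \<Omega> x * U_norm \<Omega> y)"
proof -
  obtain u \<sigma> l v \<tau> m where xe: "x = (u, \<sigma>, l)" and ye: "y = (v, \<tau>, m)" by (metis prod_cases3)
  define G d H e where "G = grad \<Omega> u" and "d = div_plus \<Omega> \<sigma> l" and "H = grad \<Omega> v" and "e = div_plus \<Omega> \<tau> m"
  have rx: "U_rep \<Omega> (u, \<sigma>, l) G d" unfolding G_def d_def using x xe U_space_rep by blast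
  have ry: "U_rep \<Omega> (v, \<tau>, m) H e" unfolding H_def e_def using y ye U_space_rep by blast
  note X = U_repD[OF rx] and Y = U_repD[OF ry]
  have C: "C > 0" using friedrichs by (simp add: friedrichs_constant_def)
  let ?X = "U_norm \<Omega> x" and ?Y = "U_norm \<Omega> y"
  have nX: "L2_norm \<Omega> G \<le> ?X" "L2_norm \<Omega> \<sigma> \<le> ?X" "L2_norm \<Omega> d \<le> ?X"
    unfolding xe U_norm_eq[OF rx] by (auto intro!: real_le_rsqrt)
  have nY: "L2_norm \<Omega> H \<le> ?Y" "L2_norm \<Omega> \<tau> \<le> ?Y" "L2_norm \<Omega> e \<le> ?Y"
    unfolding ye U_norm_eq[OF ry] by (auto intro!: real_le_rsqrt)
  have X0: "0 \<le> ?X" and Y0: "0 \<le> ?Y" using nX(1) nY(1) L2_norm_nonneg order_trans by blast+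
  note CS = L2_inner_le_mult
  have fX: "L2_norm \<Omega> u \<le> C * ?X" and fY: "L2_norm \<Omega> v \<le> C * ?Y"
    using friedrichs X(1) Y(1) nX(1) nY(1) mult_left_mono[OF _ less_imp_le[OF C]]
    unfolding friedrichs_constant_def G_def H_def by (meson order_trans)+
  define P where "P = ?X * ?Y"
  have "\<bar>L2_inner \<Omega> d e\<bar> \<le> P" unfolding P_def using X Y nX nY by (intro CS)
  then have "\<bar>\<beta> * L2_inner \<Omega> d e\<bar> \<le> \<beta> * P"
    using \<beta> by (simp add: abs_mult mult_left_mono)
  moreover have "\<bar>L2_inner \<Omega> (G - \<sigma>) (H - \<tau>)\<bar> \<le> (?X + ?X) * (?Y + ?Y)"
    using X Y nX nY L2_norm_triangle_diff[OF X(6,3)] L2_norm_triangle_diff[OF Y(6,3)]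
    by (intro CS L2_diff) linarith+
  then have "\<bar>L2_inner \<Omega> (G - \<sigma>) (H - \<tau>)\<bar> \<le> 4 * P" by (simp add: P_def)
  moreover have "\<bar>L2_inner \<Omega> e u\<bar> \<le> ?Y * (C * ?X)" "\<bar>L2_inner \<Omega> d v\<bar> \<le> ?X * (C * ?Y)"
    using CS[OF Y(7) H01_L2[OF X(1)] nY(3) fX] CS[OF X(7) H01_L2[OF Y(1)] nX(3) fY] .
  then have "\<bar>L2_inner \<Omega> e u\<bar> \<le> C * P" "\<bar>L2_inner \<Omega> d v\<bar> \<le> C * P"
    by (simp_all add: P_def mult.left_commute mult.commute)
  moreover have "\<bar>L2_inner \<Omega> \<tau> G\<bar> \<le> P" "\<bar>L2_inner \<Omega> \<sigma> H\<bar> \<le> P"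
    using CS[OF Y(3) X(6) nY(2) nX(1)] CS[OF X(3) Y(6) nX(2) nY(1)] by (simp_all add: P_def mult.commute)
  moreover have "a_form \<Omega> \<beta> x y = \<beta> * L2_inner \<Omega> d e + L2_inner \<Omega> (G - \<sigma>) (H - \<tau>)
      + L2_inner \<Omega> e u / 2 + L2_inner \<Omega> \<tau> G / 2 + L2_inner \<Omega> d v / 2 + L2_inner \<Omega> \<sigma> H / 2"
    unfolding xe ye a_form_eq[OF rx ry] U_rep_pairing[OF rx Y(1,2)] U_rep_pairing[OF ry X(1,2)]
    by (simp add: add_divide_distrib)
  moreover have "(\<beta> + C + 5) * P = \<beta> * P + C * P + 5 * P"
    by (simp add: distrib_right)
  ultimately have "\<bar>a_form \<Omega> \<beta> x y\<bar> \<le> (\<beta> + C + 5) * P" by linarith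
  then show ?thesis unfolding P_def .
qed


section \<open>The obstacle problem\<close>

text \<open>Collecting the data terms, the variational inequality depends on \<open>\<sigma>\<close> and \<open>f\<close> only through the
  residuals \<open>\<beta> (div \<sigma> + \<lambda> + f)\<close> and \<open>\<nabla>u - \<sigma>\<close>.\<close>

lemma VI_direction:
  assumes VI: "solves_VI \<Omega> \<beta> f g (Ks \<Omega> g) (u, \<sigma>, l)"
    and f: "f \<in> L2 \<Omega>" and g: "g \<in> H01 \<Omega>"
    and r: "U_rep \<Omega> (v, \<tau>, m) H e"
    and v: "nonneg_ae \<Omega> (u + v - g)" and m: "nonneg_functional \<Omega> (l + m)"
  shows "0 \<le> L2_inner \<Omega> (\<beta> *\<^sub>R (div_plus \<Omega> \<sigma> l + f)) e + L2_inner \<Omega> (grad \<Omega> u - \<sigma>) (H - \<tau>)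
    + (m (u - g) + l v) / 2"
proof -
  have "(u, \<sigma>, l) \<in> U_space \<Omega>" using VI by (auto simp: solves_VI_def Ks_def)
  note rx = U_space_rep[OF this]
  have "(u + v, \<sigma> + \<tau>, l + m) \<in> Ks \<Omega> g"
    using U_rep_U_space[OF U_rep_add[OF rx r]] v m by (simp add: Ks_def)
  then have "F_form \<Omega> \<beta> f g ((u + v, \<sigma> + \<tau>, l + m) - (u, \<sigma>, l))
      \<le> a_form \<Omega> \<beta> (u, \<sigma>, l) ((u + v, \<sigma> + \<tau>, l + m) - (u, \<sigma>, l))"
    using VI unfolding solves_VI_def by blast
  then have "F_form \<Omega> \<beta> f g (v, \<tau>, m) \<le> a_form \<Omega> \<beta> (u, \<sigma>, l) (v, \<tau>, m)" by simp
  then show ?thesis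
    unfolding a_form_eq[OF rx r] F_form_eq[OF r f]
    using Hm1_diff_arg[OF U_repD(4)[OF r] U_repD(1)[OF rx] g] U_repD(7)[OF rx] U_repD(7)[OF r] f
    by (simp add: L2_inner_scaleR_left L2_inner_add_left distrib_left diff_divide_distrib add_divide_distrib)
qed

text \<open>Test with the negative part of \<open>k\<close>.\<close>

lemma AE_nonneg_if_L2_inner_nonneg:
  assumes k: "k \<in> L2 \<Omega>"
    and nonneg: "\<And>p. p \<in> L2 \<Omega> \<Longrightarrow> (\<And>x. 0 \<le> p x) \<Longrightarrow> 0 \<le> L2_inner \<Omega> k p"
  shows "AE x in lebesgue_on \<Omega>. 0 \<le> (k x :: real)"
proof -
  define p where "p x = max 0 (- k x)" for x
  have p: "p \<in> L2 \<Omega>"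
    unfolding p_def using L2_measurable[OF k]
    by (intro L2_bounded_image[OF k, where T = "\<lambda>y. max 0 (- y)" and C = 1]) (measurable, auto)
  have "0 \<le> L2_inner \<Omega> k p" using p by (rule nonneg) (simp add: p_def)
  moreover have "k x * p x = - (p x * p x)" for x by (auto simp: p_def max_def)
  then have "L2_inner \<Omega> k p = - L2_inner \<Omega> p p" by (simp add: L2_inner_def)
  ultimately have "L2_inner \<Omega> p p = 0"
    using L2_inner_self_nonneg[of \<Omega> p] by linarith
  then have "AE x in lebesgue_on \<Omega>. p x = 0"
    using L2_inner_self_eq_0_iff[OF p] by blast
  then show ?thesis by eventually_elim (auto simp: p_def max_def split: if_splits)
qed

text \<open>That the residuals vanish is read off from the variational inequality, without solving the
  obstacle problem: once \<open>w\<close> is known to lie in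
  \<open>H\<^sub>0\<^sup>1\<close> with \<open>\<nabla>w = - s\<close>, \<open>w\<close> may be paired with \<open>\<lambda>\<close> and added to \<open>u\<close>, and two well-chosen
  competitors give \<open>2 (s, s) \<le> \<langle>\<lambda>, w\<rangle> \<le> - \<langle>\<lambda>, u - g\<rangle> / 2 \<le> 0\<close>.\<close>

lemma obstacle_VI_residuals_vanish:
  assumes VI: "solves_VI \<Omega> \<beta> f g (Ks \<Omega> g) (u, \<sigma>, l)"
    and f: "f \<in> L2 \<Omega>" and g: "g \<in> H01 \<Omega>"
    and friedrichs: "friedrichs_constant \<Omega> C"
  defines "w \<equiv> \<beta> *\<^sub>R (div_plus \<Omega> \<sigma> l + f)" and "s \<equiv> grad \<Omega> u - \<sigma>"
  shows "L2_inner \<Omega> s s = 0" "L2_inner \<Omega> w w = 0"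
proof -
  have U: "(u, \<sigma>, l) \<in> U_space \<Omega>" and ug: "nonneg_ae \<Omega> (u - g)" and l: "nonneg_functional \<Omega> l"
    using VI by (auto simp: solves_VI_def Ks_def)
  define d where "d = div_plus \<Omega> \<sigma> l"
  have rx: "U_rep \<Omega> (u, \<sigma>, l) (grad \<Omega> u) d" unfolding d_def by (rule U_space_rep[OF U])
  note X = U_repD[OF rx]
  note test = VI_direction[OF VI f g, folded w_def s_def]
  have wL: "w \<in> L2 \<Omega>" and sL: "s \<in> L2 \<Omega>"
    unfolding w_def s_def using X f by (auto simp: d_def[symmetric])
  \<comment> \<open>Varying \<open>\<sigma>\<close> by \<open>\<tau>\<close> with \<open>div \<tau> \<in> L\<^sup>2\<close> shows that \<open>w\<close> lies in \<open>H\<^sub>0\<^sup>1\<close> with gradient \<open>- s\<close>.\<close>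
  have orth: "L2_inner \<Omega> w a + L2_inner \<Omega> (- s) \<tau> = 0"
    if a: "a \<in> L2 \<Omega>" and \<tau>: "\<tau> \<in> L2 \<Omega>"
      and div: "\<And>v. v \<in> H01 \<Omega> \<Longrightarrow> L2_inner \<Omega> a v + L2_inner \<Omega> \<tau> (grad \<Omega> v) = 0" for a \<tau>
  proof -
    have r: "U_rep \<Omega> (0, \<tau>, 0) 0 a"
      using a \<tau> div H01_0[OF \<Omega>] has_weak_grad_0[OF \<Omega>] Hm1_0 by (simp add: U_rep_def represents_iff)
    have "0 \<le> L2_inner \<Omega> w a + L2_inner \<Omega> s (0 - \<tau>) + (0 (u - g) + l 0) / 2"
      using test[OF r] ug l by simp
    moreover have "0 \<le> L2_inner \<Omega> w (- a) + L2_inner \<Omega> s (0 - - \<tau>) + (0 (u - g) + l 0) / 2"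
      using test[of 0 "- \<tau>" 0 0 "- a"] U_rep_minus[OF r] ug l by simp
    moreover have "l 0 = 0" using Hm1_scaleR_arg[OF X(4) H01_0[OF \<Omega>], of 0] by simp
    ultimately show ?thesis by (simp add: L2_inner_minus_right L2_inner_minus_left)
  qed
  have w: "w \<in> H01 \<Omega>" and grad_w: "AE x in lebesgue_on \<Omega>. grad \<Omega> w x = (- s) x"
    by (rule H01_if_orthogonal_to_divergences[OF \<Omega> wL L2_minus[OF sL] orth], assumption+)+
  have grad_w_inner: "L2_inner \<Omega> \<tau> (grad \<Omega> w) = - L2_inner \<Omega> \<tau> s" if "\<tau> \<in> L2 \<Omega>" for \<tau>
  proof -
    have "L2_inner \<Omega> \<tau> (grad \<Omega> w) = L2_inner \<Omega> \<tau> (- s)"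
      by (rule L2_inner_AE_cong[OF _ grad_w that that grad_L2[OF w] L2_minus[OF sL]]) simp
    then show ?thesis by (simp add: L2_inner_minus_right)
  qed
  \<comment> \<open>Adding to \<open>\<lambda>\<close> a non-negative \<open>p \<in> L\<^sup>2\<close> shows \<open>w + (u - g) / 2 \<ge> 0\<close>, so that \<open>u + 2 w\<close> is
    admissible.\<close>
  define k where "k = w + (1/2) *\<^sub>R (u - g)"
  have ugH: "u - g \<in> H01 \<Omega>" by (rule H01_diff[OF \<Omega> X(1) g])
  have kL: "k \<in> L2 \<Omega>" unfolding k_def using wL H01_L2[OF ugH] by auto
  have "AE x in lebesgue_on \<Omega>. 0 \<le> k x"
  proof (rule AE_nonneg_if_L2_inner_nonneg[OF kL])
    fix p :: "'a \<Rightarrow> real" assume p: "p \<in> L2 \<Omega>" "\<And>x. 0 \<le> p x"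
    have r: "U_rep \<Omega> (0, 0, L2_inner \<Omega> p) 0 p"
      using p L2_inner_Hm1 H01_0[OF \<Omega>] has_weak_grad_0[OF \<Omega>] by (simp add: U_rep_def represents_iff)
    have "0 \<le> L2_inner \<Omega> p v" if "nonneg_ae \<Omega> v" for v
      unfolding L2_inner_def using that p(2)
      by (intro integral_nonneg_AE) (auto simp: nonneg_ae_def)
    then have "nonneg_functional \<Omega> (l + L2_inner \<Omega> p)"
      using l by (auto simp: nonneg_functional_def)
    then have "0 \<le> L2_inner \<Omega> w p + L2_inner \<Omega> s (0 - 0) + (L2_inner \<Omega> p (u - g) + l 0) / 2"
      using test[OF r] ug by simp
    moreover have "l 0 = 0" using Hm1_scaleR_arg[OF X(4) H01_0[OF \<Omega>], of 0] by simp
    ultimately show "0 \<le> L2_inner \<Omega> k p"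
      unfolding k_def L2_inner_add_left[OF wL L2_scaleR[OF H01_L2[OF ugH]] p(1)]
      by (simp add: L2_inner_scaleR_left L2_inner_commute[of \<Omega> "u - g" p])
  qed
  then have admissible: "nonneg_ae \<Omega> (u + 2 *\<^sub>R w - g)"
    unfolding nonneg_ae_def by eventually_elim (simp add: k_def scaleR_fun_def field_simps)
  have r: "U_rep \<Omega> (2 *\<^sub>R w, 0, 0) (2 *\<^sub>R grad \<Omega> w) 0"
    using H01_scaleR[OF \<Omega> w] has_weak_grad_scaleR[OF \<Omega> H01_weak_grad[OF w]] Hm1_0
    by (simp add: U_rep_def represents_iff)
  have "0 \<le> L2_inner \<Omega> w 0 + L2_inner \<Omega> s (2 *\<^sub>R grad \<Omega> w - 0) + (0 (u - g) + l (2 *\<^sub>R w)) / 2"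
    using test[OF r admissible] l by simp
  then have ss: "2 * L2_inner \<Omega> s s \<le> l w"
    using grad_w_inner[OF sL] Hm1_scaleR_arg[OF X(4) w] by (simp add: L2_inner_scaleR_right)
  \<comment> \<open>Replacing \<open>(\<sigma>, \<lambda>)\<close> by zero bounds \<open>\<langle>\<lambda>, w\<rangle>\<close> from above.\<close>
  have r: "U_rep \<Omega> (0, - \<sigma>, - l) 0 (- d)"
    using U_rep_minus[OF rx] H01_0[OF \<Omega>] has_weak_grad_0[OF \<Omega>] by (simp add: U_rep_def)
  have "0 \<le> L2_inner \<Omega> w (- d) + L2_inner \<Omega> s (0 - - \<sigma>) + ((- l) (u - g) + l 0) / 2"
    using test[OF r] ug by (simp add: nonneg_functional_def)
  moreover have "l 0 = 0" using Hm1_scaleR_arg[OF X(4) H01_0[OF \<Omega>], of 0] by simp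
  moreover have "l w = L2_inner \<Omega> w d - L2_inner \<Omega> s \<sigma>"
    using U_rep_pairing[OF rx w H01_weak_grad[OF w]] grad_w_inner[OF X(3)]
    by (simp add: L2_inner_commute)
  moreover have "0 \<le> l (u - g)"
    using l ug ugH by (simp add: nonneg_functional_def)
  ultimately have "l w \<le> 0" by (simp add: L2_inner_minus_right)
  then show s0: "L2_inner \<Omega> s s = 0"
    using ss L2_inner_self_nonneg[of \<Omega> s] by linarith
  have "L2_norm \<Omega> (grad \<Omega> w) = 0"
    using L2_norm_AE_cong[OF grad_w grad_L2[OF w] L2_minus[OF sL]] s0
    by (simp only: L2_norm_minus) (simp add: L2_norm_def)
  then have "L2_norm \<Omega> w \<le> 0"
    using friedrichs w unfolding friedrichs_constant_def by (metis mult_zero_right)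
  then have "L2_norm \<Omega> w = 0" using L2_norm_nonneg[of \<Omega> w] by linarith
  then show "L2_inner \<Omega> w w = 0" by (simp flip: L2_norm_power2)
qed

text \<open>With vanishing residuals only the duality terms survive. On arbitrary, not necessarily
  admissible, directions this identity replaces Galerkin orthogonality.\<close>

lemma obstacle_VI_consistency:
  assumes VI: "solves_VI \<Omega> \<beta> f g (Ks \<Omega> g) (u, \<sigma>, l)"
    and f: "f \<in> L2 \<Omega>" and g: "g \<in> H01 \<Omega>"
    and friedrichs: "friedrichs_constant \<Omega> C"
    and z: "(v, \<tau>, m) \<in> U_space \<Omega>"
  shows "a_form \<Omega> \<beta> (u, \<sigma>, l) (v, \<tau>, m) - F_form \<Omega> \<beta> f g (v, \<tau>, m) = (l v + m (u - g)) / 2"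
proof -
  have "(u, \<sigma>, l) \<in> U_space \<Omega>" using VI by (auto simp: solves_VI_def Ks_def)
  note rx = U_space_rep[OF this] and rz = U_space_rep[OF z]
  note X = U_repD[OF rx] and Z = U_repD[OF rz]
  let ?d = "div_plus \<Omega> \<sigma> l" and ?e = "div_plus \<Omega> \<tau> m"
  let ?w = "\<beta> *\<^sub>R (?d + f)" and ?s = "grad \<Omega> u - \<sigma>"
  note zero = obstacle_VI_residuals_vanish[OF VI f g friedrichs]
  have "\<bar>L2_inner \<Omega> ?w ?e\<bar> \<le> 0"
    using L2_Cauchy_Schwarz[of ?w \<Omega> ?e] X Z f zero(2) by (simp add: L2_norm_def[of _ ?w] L2_add L2_scaleR)
  then have w: "\<beta> * L2_inner \<Omega> ?d ?e + \<beta> * L2_inner \<Omega> f ?e = 0"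
    using X Z f by (simp add: L2_inner_scaleR_left L2_inner_add_left distrib_left)
  have "\<bar>L2_inner \<Omega> ?s (grad \<Omega> v - \<tau>)\<bar> \<le> 0"
    using L2_Cauchy_Schwarz[of ?s \<Omega> "grad \<Omega> v - \<tau>"] X Z zero(1)
    by (simp add: L2_norm_def[of _ ?s] L2_diff)
  then show ?thesis
    unfolding a_form_eq[OF rx rz] F_form_eq[OF rz f]
    using w Hm1_diff_arg[OF Z(4) X(1) g] by (simp add: field_simps)
qed

text \<open>Falk's argument, with \<open>x, x'\<close> for the exact and the discrete solution and \<open>y, y'\<close> for their
  competitors. The sum of the two variational inequalities bounds \<open>a (x - x', x - x')\<close> by the
  consistency terms in the directions \<open>y - x'\<close> and \<open>y' - x\<close> plus \<open>a (x - x', x - y')\<close>; coercivity,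
  boundedness and Young's inequality finish the estimate.\<close>

lemma VI_error_estimate:
  assumes f: "f \<in> L2 \<Omega>" and g: "g \<in> H01 \<Omega>"
    and friedrichs: "friedrichs_constant \<Omega> C" and \<beta>: "\<beta> \<ge> 1 + C\<^sup>2"
    and VI: "solves_VI \<Omega> \<beta> f g (Ks \<Omega> g) (u, \<sigma>, l)"
    and K: "K \<subseteq> U_space \<Omega>" and VI': "solves_VI \<Omega> \<beta> f g K (u', \<sigma>', l')"
    and vh: "(vh, \<tau>h, mh) \<in> K" and v: "(v, \<tau>, m) \<in> Ks \<Omega> g"
  shows "(U_norm \<Omega> ((u, \<sigma>, l) - (u', \<sigma>', l')))\<^sup>2 \<le> (4 + 16 * (\<beta> + C + 5)\<^sup>2) *
    (((U_norm \<Omega> ((u, \<sigma>, l) - (vh, \<tau>h, mh)))\<^sup>2 + \<bar>l (vh - u) + (mh - l) (u - g)\<bar>)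
     + \<bar>l (v - u') + (m - l') (u - g)\<bar>)"
proof -
  define x x' y y' where "x = (u, \<sigma>, l)" and "x' = (u', \<sigma>', l')" and "y = (v, \<tau>, m)" and "y' = (vh, \<tau>h, mh)"
  let ?a = "a_form \<Omega> \<beta>" and ?F = "F_form \<Omega> \<beta> f g"
  have U: "x \<in> U_space \<Omega>" "x' \<in> U_space \<Omega>" "y \<in> U_space \<Omega>" "y' \<in> U_space \<Omega>"
    using VI VI' K vh v by (auto simp: x_def x'_def y_def y'_def solves_VI_def Ks_def)
  define A B where "A = l (vh - u) + (mh - l) (u - g)" and "B = l (v - u') + (m - l') (u - g)"
  have A: "?a x (y' - x) - ?F (y' - x) = A / 2"
    using obstacle_VI_consistency[OF VI f g friedrichs, of "vh - u" "\<tau>h - \<sigma>" "mh - l"]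
      U_space_diff[OF U(4,1)] by (simp add: A_def x_def y'_def)
  have B: "?a x (y - x') - ?F (y - x') = B / 2"
    using obstacle_VI_consistency[OF VI f g friedrichs, of "v - u'" "\<tau> - \<sigma>'" "m - l'"]
      U_space_diff[OF U(3,2)] by (simp add: B_def x_def y_def x'_def)
  have "?F (y - x) \<le> ?a x (y - x)"
    using VI v unfolding solves_VI_def x_def y_def by blast
  moreover have "?F (y' - x') \<le> ?a x' (y' - x')"
    using VI' vh unfolding solves_VI_def x'_def y'_def by blast
  moreover have "?a (x - x') (x - x') = (?a x x - ?a x x') - (?a x' x - ?a x' x')"
    and "?a (x - x') (x - y') = (?a x x - ?a x y') - (?a x' x - ?a x' y')"
    using U by (simp_all add: a_form_diff_left a_form_diff_right U_space_diff)
  moreover have "?a p (q - r) = ?a p q - ?a p r" "?F (q - r) = ?F q - ?F r"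
    if "p \<in> U_space \<Omega>" "q \<in> U_space \<Omega>" "r \<in> U_space \<Omega>" for p q r
    using that f by (simp_all add: a_form_diff_right F_form_diff)
  note this[OF U(1,4,1)] this[OF U(1,3,2)] this[OF U(1,3,1)] this[OF U(2,4,2)]
  ultimately have Falk: "?a (x - x') (x - x') \<le> A / 2 + B / 2 + ?a (x - x') (x - y')"
    using A B by linarith
  define M N Y where "M = \<beta> + C + 5" and "N = U_norm \<Omega> (x - x')" and "Y = U_norm \<Omega> (x - y')"
  have "\<beta> \<ge> 0" using \<beta> zero_le_power2[of C] by linarith
  then have "?a (x - x') (x - y') \<le> M * (N * Y)"
    using a_form_bounded[OF U_space_diff[OF U(1,2)] U_space_diff[OF U(1,4)] friedrichs]
    by (force simp: M_def N_def Y_def)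
  moreover have "N\<^sup>2 \<le> 4 * ?a (x - x') (x - x')"
    unfolding N_def by (rule a_form_coercive[OF U_space_diff[OF U(1,2)] friedrichs \<beta>])
  \<comment> \<open>Weighted so that half of the coercive term \<open>N\<^sup>2\<close> survives.\<close>
  moreover have "8 * (M * (N * Y)) \<le> N\<^sup>2 + 16 * M\<^sup>2 * Y\<^sup>2"
    using zero_le_power2[of "N - 4 * M * Y"] by (simp add: power2_diff power_mult_distrib algebra_simps)
  ultimately have "N\<^sup>2 \<le> 4 * A + 4 * B + 16 * M\<^sup>2 * Y\<^sup>2"
    using Falk by linarith
  also have "\<dots> = 4 * (A + B) + 16 * M\<^sup>2 * Y\<^sup>2" by simp
  also have "\<dots> \<le> 4 * (Y\<^sup>2 + \<bar>A\<bar> + \<bar>B\<bar>) + 16 * M\<^sup>2 * (Y\<^sup>2 + \<bar>A\<bar> + \<bar>B\<bar>)"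
  proof (rule add_mono; rule mult_left_mono)
    have "0 \<le> Y\<^sup>2" by simp
    then show "A + B \<le> Y\<^sup>2 + \<bar>A\<bar> + \<bar>B\<bar>" by linarith
  qed auto
  also have "\<dots> = (4 + 16 * M\<^sup>2) * (Y\<^sup>2 + \<bar>A\<bar> + \<bar>B\<bar>)" by (simp add: distrib_right)
  finally show ?thesis
    unfolding N_def Y_def M_def A_def B_def x_def x'_def y'_def .
qed

end

theorem theorem8:
  fixes \<Omega> :: "(real ^ 'n) set" and \<beta> C\<^sub>F :: real
  assumes dim: "CARD('n) = 2 \<or> CARD('n) = 3"
    and domain: "lipschitz_domain \<Omega>" "polyhedral_domain \<Omega>"
    and friedrichs: "friedrichs_constant \<Omega> C\<^sub>F"
    and beta: "\<beta> \<ge> 1 + C\<^sub>F\<^sup>2"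
  shows "\<exists>C\<^sub>o\<^sub>p\<^sub>t>0. \<forall>f\<in>L2 \<Omega>. \<forall>g\<in>H01 \<Omega>. \<forall>u \<sigma> l K\<^sub>h u\<^sub>h \<sigma>\<^sub>h l\<^sub>h.
           solves_VI \<Omega> \<beta> f g (Ks \<Omega> g) (u, \<sigma>, l) \<longrightarrow>
           K\<^sub>h \<subseteq> U_space \<Omega> \<longrightarrow> K\<^sub>h \<noteq> {} \<longrightarrow> convex K\<^sub>h \<longrightarrow> U_closed \<Omega> K\<^sub>h \<longrightarrow>
           solves_VI \<Omega> \<beta> f g K\<^sub>h (u\<^sub>h, \<sigma>\<^sub>h, l\<^sub>h) \<longrightarrow>
           (U_norm \<Omega> ((u, \<sigma>, l) - (u\<^sub>h, \<sigma>\<^sub>h, l\<^sub>h)))\<^sup>2 \<le>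
             C\<^sub>o\<^sub>p\<^sub>t *
             ((INF (v\<^sub>h, \<tau>\<^sub>h, m\<^sub>h)\<in>K\<^sub>h.
                 (U_norm \<Omega> ((u, \<sigma>, l) - (v\<^sub>h, \<tau>\<^sub>h, m\<^sub>h)))\<^sup>2
                 + \<bar>l (v\<^sub>h - u) + (m\<^sub>h - l) (u - g)\<bar>)
              + (INF (v, \<tau>, m)\<in>Ks \<Omega> g. \<bar>l (v - u\<^sub>h) + (m - l\<^sub>h) (u - g)\<bar>))"
proof (intro exI[of _ "4 + 16 * (\<beta> + C\<^sub>F + 5)\<^sup>2"] conjI ballI allI impI)
  show "0 < 4 + 16 * (\<beta> + C\<^sub>F + 5)\<^sup>2" by (simp add: add_pos_nonneg)
next
  fix f g u \<sigma> l K u' \<sigma>' l'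
  assume f: "f \<in> L2 \<Omega>" and g: "g \<in> H01 \<Omega>"
    and VI: "solves_VI \<Omega> \<beta> f g (Ks \<Omega> g) (u, \<sigma>, l)" and K: "K \<subseteq> U_space \<Omega>" "K \<noteq> {}"
    and VI': "solves_VI \<Omega> \<beta> f g K (u', \<sigma>', l')"
  have \<Omega>: "open \<Omega>" using domain(1) by (simp add: lipschitz_domain_def)
  let ?C = "4 + 16 * (\<beta> + C\<^sub>F + 5)\<^sup>2"
  let ?P = "\<lambda>(v\<^sub>h, \<tau>\<^sub>h, m\<^sub>h). (U_norm \<Omega> ((u, \<sigma>, l) - (v\<^sub>h, \<tau>\<^sub>h, m\<^sub>h)))\<^sup>2 + \<bar>l (v\<^sub>h - u) + (m\<^sub>h - l) (u - g)\<bar>"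
  let ?Q = "\<lambda>(v, \<tau>, m). \<bar>l (v - u') + (m - l') (u - g)\<bar>"
  define N where "N = (U_norm \<Omega> ((u, \<sigma>, l) - (u', \<sigma>', l')))\<^sup>2"
  have C: "?C > 0" by (simp add: add_pos_nonneg)
  have est: "N / ?C \<le> ?P z + ?Q y" if "z \<in> K" "y \<in> Ks \<Omega> g" for z y
    using VI_error_estimate[OF \<Omega> f g friedrichs beta VI K(1) VI'] that C
    by (cases z; cases y) (simp add: N_def pos_divide_le_eq mult.commute)
  have "Ks \<Omega> g \<noteq> {}" using VI by (auto simp: solves_VI_def)
  have "N / ?C - ?P z \<le> (INF y\<in>Ks \<Omega> g. ?Q y)" if "z \<in> K" for z
    using \<open>Ks \<Omega> g \<noteq> {}\<close> by (rule cINF_greatest) (use est[OF that] in \<open>simp add: algebra_simps\<close>)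
  then have "N / ?C - (INF y\<in>Ks \<Omega> g. ?Q y) \<le> ?P z" if "z \<in> K" for z
    using that by (simp add: algebra_simps)
  then have "N / ?C - (INF y\<in>Ks \<Omega> g. ?Q y) \<le> (INF z\<in>K. ?P z)"
    using K(2) by (intro cINF_greatest)
  then have "N \<le> ?C * ((INF z\<in>K. ?P z) + (INF y\<in>Ks \<Omega> g. ?Q y))"
    using C by (simp add: diff_le_eq pos_divide_le_eq mult.commute)
  then show "(U_norm \<Omega> ((u, \<sigma>, l) - (u', \<sigma>', l')))\<^sup>2 \<le> ?C * ((INF z\<in>K. ?P z) + (INF y\<in>Ks \<Omega> g. ?Q y))"
    unfolding N_def .
qed

end
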